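(* Let $X$ be a metric space that is compact, locally path connected and semi-locally simply connected, and let $x_0\in X$. Then the natural discretisation homomorphism $\pi_1(X,x_0)\to\varprojlim_{\theta}\pi_{1,\theta}(X,x_0)$ from the fundamental group to the inverse limit of the discrete fundamental groups is an isomorphism; in particular $\pi_1(X,x_0)\cong\varprojlim_{\theta}\pi_{1,\theta}(X,x_0)$.
   Context: $X$ is a metric space with metric $d$; $B(x,r)$ and $\overline B(x,r)$ denote the open and closed balls of radius $r$ centred at $x$. Local conditions. $X$ is locally path connected if for every $x\in X$ and neighbourhood $U$ of $x$ there is a neighbourhood $V\subseteq U$ of $x$ such that every two points in $V$ are joined by a path in $U$. $X$ is semi-locally simply connected if for every $x\in X$ there is $\epsilon(x)>0$ such that every loop with image contained in $B(x,\epsilon(x))$ is null-homotopic in $X$ (not necessarily in the ball). Discrete fundamental group. Fix $\theta>0$. For $n\in\mathbb{N}$ let $[n]=\{0,1,\dots,n\}$, seen as a subset of $\mathbb{R}$. A $\theta$-path is a $\theta$-Lipschitz map $Z\colon[n]\to X$, equivalently a finite sequence $(z_0,\dots,z_n)$ of points of $X$ with $d(z_i,z_{i+1})\leq\theta$ for all $i$. It is closed if $z_0=z_n$. A $\theta$-path $Z'\colon[m]\to X$ is a lazy version (lazification) of $Z\colon[n]\to X$ if $m>n$ and $Z'=Z\circ f$ for some surjective monotone map $f\colon[m]\to[n]$. For two $\theta$-paths $Z_1,Z_2$ of the same length $n$ with the same endpoints, a $\theta$-grid homotopy between them is a $\theta$-Lipschitz map $H\colon[n]\times[m]\to X$ (with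 the $\ell^1$ metric on $[n]\times[m]$) such that $H(\cdot,0)=Z_1$, $H(\cdot,m)=Z_2$, and $H(0,t)=Z_1(0)=Z_2(0)$, $H(n,t)=Z_1(n)=Z_2(n)$ for every $t\in[m]$. Two $\theta$-paths are $\theta$-homotopic if they are equivalent under the equivalence relation generated by lazifications and $\theta$-grid homotopies. The discrete fundamental group at scale $\theta$, denoted $\pi_{1,\theta}(X,x_0)$, is the group of $\theta$-homotopy classes of closed $\theta$-paths with endpoints $x_0$, with the operation of concatenation. Inverse limit. For $\theta'\leq\theta$ every $\theta'$-path is a $\theta$-path and every $\theta'$-homotopy is a $\theta$-homotopy, giving natural homomorphisms $\pi_{1,\theta'}(X,x_0)\to\pi_{1,\theta}(X,x_0)$; $\varprojlim_\theta\pi_{1,\theta}(X,x_0)$ is the inverse limit of this system over all $\theta>0$. Discretisation homomorphism. For a continuous path $\gamma\colon[0,1]\to X$ and times $0=t_0\leq t_1\leq\dots\leq t_n=1$, the $\theta$-path $(\gamma(t_0),\dots,\gamma(t_n))$ is a $\theta$-discretisation of $\gamma$ if $\gamma\bigl((t_{i-1},t_i)\bigr)\subseteq\overline B(\gamma(t_{i-1}),\theta)$ for every $i=1,\dots,n$. Every continuous path admits a $\theta$-discretisation, and sending the homotopy class of a loop $\gamma$ at $x_0$ to the $\theta$-homotopy class of any of its $\theta$-discretisations gives a well-defined homomorphism $\pi_1(X,x_0)\to\pi_{1,\theta}(X,x_0)$, compatible with the natural homomorphisms $\pi_{1,\theta'}(X,x_0)\to\pi_{1,\theta}(X,x_0)$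 for $\theta'\leq\theta$. These induce the discretisation homomorphism $\pi_1(X,x_0)\to\varprojlim_\theta\pi_{1,\theta}(X,x_0)$. *)

theory Defs
  imports "HOL-Analysis.Analysis" "HOL-Algebra.Product_Groups"
begin

section \<open>Local conditions\<close>

text \<open>
  Local path connectedness is the library's \<^term>\<open>locally path_connected X\<close>; it agrees with the
  formulation in which any two points of a small neighbourhood are joined by a path in the
  given, larger one.
\<close>

lemma locally_path_connected_iff_joined_in_larger:
  "locally path_connected X \<longleftrightarrow>
     (\<forall>x\<in>X. \<forall>U. openin (top_of_set X) U \<and> x \<in> U \<longrightarrow>
       (\<exists>V. openin (top_of_set X) V \<and> x \<in> V \<and> V \<subseteq> U \<and>
         (\<forall>a\<in>V. \<forall>b\<in>V. \<exists>p. path p \<and> path_image p \<subseteq> U \<and> pathstart p = a \<and> pathfinish p = b)))"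
  (is "?L \<longleftrightarrow> ?R")
proof
  assume L: ?L
  show ?R
  proof (intro ballI allI impI)
    fix x U assume "x \<in> X" and U: "openin (top_of_set X) U \<and> x \<in> U"
    from locallyE[OF L conjunct1[OF U] conjunct2[OF U]] obtain V W
      where VW: "openin (top_of_set X) V" "path_connected W" "x \<in> V" "V \<subseteq> W" "W \<subseteq> U" .
    have "\<exists>p. path p \<and> path_image p \<subseteq> U \<and> pathstart p = a \<and> pathfinish p = b"
      if "a \<in> V" "b \<in> V" for a b
    proof -
      have "a \<in> W" "b \<in> W" using that VW by auto
      with VW(2) obtain p where "path p" "path_image p \<subseteq> W" "pathstart p = a" "pathfinish p = b"
        unfolding path_connected_def by blast
      with VW(5) show ?thesis by blast
    qed
    with VW show "\<exists>V. openin (top_of_set X) V \<and> x \<in> V \<and> V \<subseteq> U \<and>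
         (\<forall>a\<in>V. \<forall>b\<in>V. \<exists>p. path p \<and> path_image p \<subseteq> U \<and> pathstart p = a \<and> pathfinish p = b)"
      by (intro exI[of _ V]) simp
  qed
next
  assume R: ?R
  show ?L
  proof (rule locallyI)
    fix U x assume U: "openin (top_of_set X) U" "x \<in> U"
    then have "x \<in> X"
      using openin_subset[OF U(1)] by auto
    with R U obtain V where V: "openin (top_of_set X) V" "x \<in> V" "V \<subseteq> U"
      and J: "\<forall>a\<in>V. \<forall>b\<in>V. path_component U a b"
      unfolding path_component_def by (elim ballE[of _ _ x] allE[of _ U]) auto
    show "\<exists>V W. openin (top_of_set X) V \<and> path_connected W \<and> x \<in> V \<and> V \<subseteq> W \<and> W \<subseteq> U"
    proof (intro exI conjI)
      show "path_connected (path_component_set U x)"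
        by (rule path_connected_path_component)
      show "V \<subseteq> path_component_set U x"
        using J V by auto
      show "path_component_set U x \<subseteq> U"
        by (rule path_component_subset)
    qed (use V in auto)
  qed
qed

definition semilocally_simply_connected :: "'a::metric_space set \<Rightarrow> bool" where
  "semilocally_simply_connected X \<longleftrightarrow>
     (\<forall>x\<in>X. \<exists>e>0. \<forall>p. path p \<and> path_image p \<subseteq> X \<inter> ball x e \<and> pathfinish p = pathstart p
        \<longrightarrow> (\<exists>a. homotopic_loops X p (\<lambda>_. a)))"


section \<open>Groups of equivalence classes\<close>

text \<open>
  The operation is written as a union over all representatives, so that a product of two
  classes is again a class exactly when it does not depend on the representatives.
\<close>

definition class_group :: "'b set \<Rightarrow> ('b \<times> 'b) set \<Rightarrow> ('b \<Rightarrow> 'b \<Rightarrow> 'b) \<Rightarrow> 'b \<Rightarrow> 'b set monoid" where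
  "class_group A r f e =
     \<lparr>carrier = A // r,
      mult = (\<lambda>P Q. \<Union>p\<in>P. \<Union>q\<in>Q. r `` {f p q}),
      one = r `` {e}\<rparr>"

context
  fixes A :: "'b set" and r and f :: "'b \<Rightarrow> 'b \<Rightarrow> 'b" and e :: 'b
  assumes eqv: "equiv A r"
    and cong: "\<And>p p' q q'. (p, p') \<in> r \<Longrightarrow> (q, q') \<in> r \<Longrightarrow> (f p q, f p' q') \<in> r"
begin

lemma class_group_mult:
  assumes "p \<in> A" "q \<in> A"
  shows "r `` {p} \<otimes>\<^bsub>class_group A r f e\<^esub> r `` {q} = r `` {f p q}"
proof -
  have "congruent2 r r (\<lambda>p q. r `` {f p q})"
    by (rule congruent2I') (metis cong eqv equiv_class_eq)
  from UN_equiv_class2[OF eqv eqv this assms] show ?thesis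
    by (simp add: class_group_def)
qed

lemma group_class_group:
  assumes closed: "\<And>p q. p \<in> A \<Longrightarrow> q \<in> A \<Longrightarrow> f p q \<in> A"
    and e: "e \<in> A"
    and assoc: "\<And>p q s. p \<in> A \<Longrightarrow> q \<in> A \<Longrightarrow> s \<in> A \<Longrightarrow> (f (f p q) s, f p (f q s)) \<in> r"
    and unit: "\<And>p. p \<in> A \<Longrightarrow> (f e p, p) \<in> r"
    and inv: "\<And>p. p \<in> A \<Longrightarrow> \<exists>q\<in>A. (f q p, e) \<in> r"
  shows "group (class_group A r f e)"
proof (rule groupI)
  let ?G = "class_group A r f e"
  have carr: "carrier ?G = A // r" and one: "\<one>\<^bsub>?G\<^esub> = r `` {e}"
    by (simp_all add: class_group_def)
  note class_group_mult[simp] closed[simp] e[simp]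
  have same: "r `` {p} = r `` {q}" if "(p, q) \<in> r" for p q
    using that eqv by (rule equiv_class_eq[rotated])
  show "x \<otimes>\<^bsub>?G\<^esub> y \<in> carrier ?G" if "x \<in> carrier ?G" "y \<in> carrier ?G" for x y
    using that unfolding carr by (auto elim!: quotientE intro!: quotientI)
  show "\<one>\<^bsub>?G\<^esub> \<in> carrier ?G"
    unfolding carr one by (simp add: quotientI)
  show "x \<otimes>\<^bsub>?G\<^esub> y \<otimes>\<^bsub>?G\<^esub> z = x \<otimes>\<^bsub>?G\<^esub> (y \<otimes>\<^bsub>?G\<^esub> z)"
    if "x \<in> carrier ?G" "y \<in> carrier ?G" "z \<in> carrier ?G" for x y z
  proof -
    from that obtain p q s where "p \<in> A" "q \<in> A" "s \<in> A" "x = r `` {p}" "y = r `` {q}" "z = r `` {s}"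
      unfolding carr by (auto elim!: quotientE)
    then show ?thesis
      using same[OF assoc[of p q s]] by simp
  qed
  show "\<one>\<^bsub>?G\<^esub> \<otimes>\<^bsub>?G\<^esub> x = x" if "x \<in> carrier ?G" for x
    using that unfolding carr one by (auto elim!: quotientE simp: same[OF unit])
  show "\<exists>y\<in>carrier ?G. y \<otimes>\<^bsub>?G\<^esub> x = \<one>\<^bsub>?G\<^esub>" if "x \<in> carrier ?G" for x
  proof -
    from that obtain p where p: "p \<in> A" "x = r `` {p}"
      unfolding carr by (auto elim: quotientE)
    with inv obtain q where "q \<in> A" "(f q p, e) \<in> r"
      by blast
    with p show ?thesis
      unfolding carr one by (intro bexI[of _ "r `` {q}"]) (auto simp: same quotientI)
  qed
qed

end


section \<open>The fundamental group\<close>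

definition based_loops :: "'a::topological_space set \<Rightarrow> 'a \<Rightarrow> (real \<Rightarrow> 'a) set" where
  "based_loops X x0 = {p. path p \<and> path_image p \<subseteq> X \<and> pathstart p = x0 \<and> pathfinish p = x0}"

definition loop_rel :: "'a::topological_space set \<Rightarrow> 'a \<Rightarrow> ((real \<Rightarrow> 'a) \<times> (real \<Rightarrow> 'a)) set" where
  "loop_rel X x0 = {(p, q). p \<in> based_loops X x0 \<and> q \<in> based_loops X x0 \<and> homotopic_paths X p q}"

definition fundamental_group :: "'a::topological_space set \<Rightarrow> 'a \<Rightarrow> (real \<Rightarrow> 'a) set monoid" where
  "fundamental_group X x0 = class_group (based_loops X x0) (loop_rel X x0) (+++) (\<lambda>_. x0)"

lemma equiv_loop_rel: "equiv (based_loops X x0) (loop_rel X x0)"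
proof (rule equivI)
  show "loop_rel X x0 \<subseteq> based_loops X x0 \<times> based_loops X x0"
    by (auto simp: loop_rel_def)
  show "refl_on (based_loops X x0) (loop_rel X x0)"
    by (auto simp: refl_on_def loop_rel_def based_loops_def)
  show "sym (loop_rel X x0)"
    by (auto simp: sym_def loop_rel_def intro: homotopic_paths_sym)
  show "trans (loop_rel X x0)"
    by (auto simp: trans_def loop_rel_def intro: homotopic_paths_trans)
qed

lemma group_fundamental_group:
  fixes X :: "'a::topological_space set"
  assumes "x0 \<in> X"
  shows "group (fundamental_group X x0)"
  unfolding fundamental_group_def
proof (rule group_class_group[OF equiv_loop_rel])
  have join: "p +++ q \<in> based_loops X x0" if "p \<in> based_loops X x0" "q \<in> based_loops X x0" for p q
    using that by (auto simp: based_loops_def subset_path_image_join)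
  then show "p +++ q \<in> based_loops X x0" if "p \<in> based_loops X x0" "q \<in> based_loops X x0" for p q
    using that .
  have const: "(\<lambda>_. x0) \<in> based_loops X x0"
    using assms by (auto simp: based_loops_def path_def path_image_def pathstart_def pathfinish_def)
  then show "(\<lambda>_. x0) \<in> based_loops X x0" .
  show "(p +++ q, p' +++ q') \<in> loop_rel X x0"
    if "(p, p') \<in> loop_rel X x0" "(q, q') \<in> loop_rel X x0" for p p' q q'
    using that by (auto simp: loop_rel_def join based_loops_def subset_path_image_join
        intro: homotopic_paths_join)
  show "((p +++ q) +++ s, p +++ (q +++ s)) \<in> loop_rel X x0"
    if "p \<in> based_loops X x0" "q \<in> based_loops X x0" "s \<in> based_loops X x0" for p q s
    using that by (auto simp: loop_rel_def join)
      (auto simp: based_loops_def intro!: homotopic_paths_sym[OF homotopic_paths_assoc])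
  show "((\<lambda>_. x0) +++ p, p) \<in> loop_rel X x0" if p: "p \<in> based_loops X x0" for p
  proof -
    have "homotopic_paths X p ((\<lambda>_. x0) +++ p)"
    proof (rule homotopic_paths_reparametrize[where f = "\<lambda>t. max 0 (2 * t - 1)"])
      show "continuous_on {0..1::real} (\<lambda>t. max 0 (2 * t - 1))"
        by (intro continuous_intros)
      show "((\<lambda>_. x0) +++ p) t = p (max 0 (2 * t - 1))" if "t \<in> {0..1}" for t
        using p by (auto simp: based_loops_def joinpaths_def pathstart_def max_absorb1 max_absorb2)
    qed (use p in \<open>auto simp: based_loops_def\<close>)
    then show ?thesis
      using p join const by (auto simp: loop_rel_def intro: homotopic_paths_sym)
  qed
  show "\<exists>q\<in>based_loops X x0. (q +++ p, \<lambda>_. x0) \<in> loop_rel X x0" if p: "p \<in> based_loops X x0" for p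
  proof -
    have rp: "reversepath p \<in> based_loops X x0"
      using p by (auto simp: based_loops_def)
    have "homotopic_paths X (reversepath p +++ p) (\<lambda>_. x0)"
    proof -
      have cp: "continuous_on {0..1} p"
        using p by (simp add: based_loops_def path_def)
      define h where "h = (\<lambda>y::real \<times> real. p (max (fst y) \<bar>1 - 2 * snd y\<bar>))"
      have "continuous_on ({0..1} \<times> {0..1}) h"
        unfolding h_def
      proof (rule continuous_on_compose2[OF cp])
        show "continuous_on ({0..1} \<times> {0..1}) (\<lambda>y::real \<times> real. max (fst y) \<bar>1 - 2 * snd y\<bar>)"
          by (intro continuous_intros)
      qed auto
      moreover have "h \<in> {0..1} \<times> {0..1} \<rightarrow> X"
      proof
        fix y :: "real \<times> real" assume "y \<in> {0..1} \<times> {0..1}"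
        then have "max (fst y) \<bar>1 - 2 * snd y\<bar> \<in> {0..1}"
          by auto
        then show "h y \<in> X"
          using p unfolding h_def based_loops_def path_image_def by blast
      qed
      moreover have "\<forall>x\<in>{0..1}. h (0, x) = (reversepath p +++ p) x"
        by (auto simp: h_def joinpaths_def reversepath_def max_def abs_if)
      moreover have "\<forall>x\<in>{0..1}. h (1, x) = x0"
        using p by (auto simp: h_def based_loops_def pathfinish_def max_def abs_if)
      moreover have "pathstart (h \<circ> Pair t) = x0 \<and> pathfinish (h \<circ> Pair t) = x0"
        if "t \<in> {0..1}" for t
        using p that by (auto simp: h_def based_loops_def pathfinish_def pathstart_def max_def)
      moreover have "pathstart (reversepath p +++ p) = x0" "pathfinish (reversepath p +++ p) = x0"
        using p by (auto simp: based_loops_def)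
      ultimately show ?thesis
        unfolding homotopic_paths by (intro exI[of _ h]) simp
    qed
    with rp p join const show ?thesis
      by (auto simp: loop_rel_def)
  qed
qed


section \<open>The discrete fundamental group\<close>

text \<open>A map from \<open>{0, ..., n}\<close> to \<open>X\<close> is represented by the list of its \<open>n + 1\<close> values.\<close>

definition theta_path :: "real \<Rightarrow> 'a::metric_space set \<Rightarrow> 'a list \<Rightarrow> bool" where
  "theta_path \<theta> X zs \<longleftrightarrow> zs \<noteq> [] \<and> set zs \<subseteq> X \<and> successively (\<lambda>x y. dist x y \<le> \<theta>) zs"

definition lazification :: "'a list \<Rightarrow> 'a list \<Rightarrow> bool" where
  "lazification zs zs' \<longleftrightarrow> length zs < length zs' \<and>
     (\<exists>f. mono_on {..<length zs'} f \<and> f ` {..<length zs'} = {..<length zs} \<and>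
          (\<forall>i<length zs'. zs' ! i = zs ! f i))"

definition theta_grid_homotopic :: "real \<Rightarrow> 'a::metric_space set \<Rightarrow> 'a list \<Rightarrow> 'a list \<Rightarrow> bool" where
  "theta_grid_homotopic \<theta> X zs ws \<longleftrightarrow>
     (\<exists>n m. \<exists>H :: nat \<Rightarrow> nat \<Rightarrow> 'a.
        length zs = Suc n \<and> length ws = Suc n \<and>
        (\<forall>i\<le>n. \<forall>j\<le>m. H i j \<in> X) \<and>
        (\<forall>i\<le>n. \<forall>j\<le>m. \<forall>i'\<le>n. \<forall>j'\<le>m.
           dist (H i j) (H i' j') \<le> \<theta> * (\<bar>real i - real i'\<bar> + \<bar>real j - real j'\<bar>)) \<and>
        (\<forall>i\<le>n. H i 0 = zs ! i \<and> H i m = ws ! i) \<and>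
        (\<forall>j\<le>m. H 0 j = zs ! 0 \<and> H 0 j = ws ! 0 \<and> H n j = zs ! n \<and> H n j = ws ! n))"

definition theta_step :: "real \<Rightarrow> 'a::metric_space set \<Rightarrow> 'a list \<Rightarrow> 'a list \<Rightarrow> bool" where
  "theta_step \<theta> X zs ws \<longleftrightarrow> theta_path \<theta> X zs \<and> theta_path \<theta> X ws \<and>
     (lazification zs ws \<or> theta_grid_homotopic \<theta> X zs ws)"

definition theta_homotopic :: "real \<Rightarrow> 'a::metric_space set \<Rightarrow> 'a list \<Rightarrow> 'a list \<Rightarrow> bool" where
  "theta_homotopic \<theta> X = equivclp (theta_step \<theta> X)"

definition theta_loops :: "real \<Rightarrow> 'a::metric_space set \<Rightarrow> 'a \<Rightarrow> 'a list set" where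
  "theta_loops \<theta> X x0 = {zs. theta_path \<theta> X zs \<and> hd zs = x0 \<and> last zs = x0}"

definition theta_loop_rel :: "real \<Rightarrow> 'a::metric_space set \<Rightarrow> 'a \<Rightarrow> ('a list \<times> 'a list) set" where
  "theta_loop_rel \<theta> X x0 =
     {(zs, ws). zs \<in> theta_loops \<theta> X x0 \<and> ws \<in> theta_loops \<theta> X x0 \<and> theta_homotopic \<theta> X zs ws}"

definition discrete_fundamental_group ::
    "real \<Rightarrow> 'a::metric_space set \<Rightarrow> 'a \<Rightarrow> 'a list set monoid" where
  "discrete_fundamental_group \<theta> X x0 =
     class_group (theta_loops \<theta> X x0) (theta_loop_rel \<theta> X x0) (\<lambda>zs ws. zs @ tl ws) [x0]"


lemma grid_homotopicI:
  fixes H :: "nat \<Rightarrow> nat \<Rightarrow> 'a::metric_space"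
  assumes len: "length zs = Suc n" "length ws = Suc n"
    and X: "\<And>i j. i \<le> n \<Longrightarrow> j \<le> m \<Longrightarrow> H i j \<in> X"
    and horiz: "\<And>i j. i < n \<Longrightarrow> j \<le> m \<Longrightarrow> dist (H i j) (H (Suc i) j) \<le> \<theta>"
    and vert: "\<And>i j. i \<le> n \<Longrightarrow> j < m \<Longrightarrow> dist (H i j) (H i (Suc j)) \<le> \<theta>"
    and "\<And>i. i \<le> n \<Longrightarrow> H i 0 = zs ! i" "\<And>i. i \<le> n \<Longrightarrow> H i m = ws ! i"
    and "\<And>j. j \<le> m \<Longrightarrow> H 0 j = zs ! 0" "\<And>j. j \<le> m \<Longrightarrow> H n j = zs ! n"
  shows "theta_grid_homotopic \<theta> X zs ws"
proof -
  have chain: "dist (g a) (g b) \<le> \<theta> * \<bar>real a - real b\<bar>"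
    if "\<And>i. i < k \<Longrightarrow> dist (g i) (g (Suc i)) \<le> \<theta>" "a \<le> k" "b \<le> k" for g :: "nat \<Rightarrow> 'a" and k a b
  proof -
    have *: "dist (g c) (g (c + d)) \<le> \<theta> * real d" if "c + d \<le> k" for c d
      using that
    proof (induction d)
      case (Suc d)
      have "dist (g c) (g (c + Suc d)) \<le> dist (g c) (g (c + d)) + dist (g (c + d)) (g (Suc (c + d)))"
        by (simp add: dist_triangle)
      with Suc \<open>\<And>i. i < k \<Longrightarrow> dist (g i) (g (Suc i)) \<le> \<theta>\<close>[of "c + d"] show ?case
        by (simp add: algebra_simps)
    qed simp
    show ?thesis
    proof (cases "a \<le> b")
      case True
      with *[of a "b - a"] that show ?thesis by (simp add: of_nat_diff)
    next
      case False
      with *[of b "a - b"] that show ?thesis by (simp add: of_nat_diff dist_commute)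
    qed
  qed
  have "dist (H i j) (H i' j') \<le> \<theta> * (\<bar>real i - real i'\<bar> + \<bar>real j - real j'\<bar>)"
    if "i \<le> n" "j \<le> m" "i' \<le> n" "j' \<le> m" for i j i' j'
  proof -
    have "dist (H i j) (H i' j) \<le> \<theta> * \<bar>real i - real i'\<bar>"
      using chain[of n "\<lambda>i. H i j"] horiz that by simp
    moreover have "dist (H i' j) (H i' j') \<le> \<theta> * \<bar>real j - real j'\<bar>"
      using chain[of m "H i'"] vert that by simp
    ultimately show ?thesis
      using dist_triangle[of "H i j" "H i' j'" "H i' j"] by (simp add: distrib_left)
  qed
  moreover have "ws ! 0 = zs ! 0" "ws ! n = zs ! n"
    using assms(7)[of 0] assms(7)[of n] assms(8)[of m] assms(9)[of m] by simp_all
  ultimately show ?thesis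
    unfolding theta_grid_homotopic_def using assms
    by (intro exI[of _ n] exI[of _ m] exI[of _ H]) simp
qed

lemma theta_homotopic_refl [simp]: "theta_homotopic \<theta> X zs zs"
  by (simp add: theta_homotopic_def)

lemma theta_homotopic_sym: "theta_homotopic \<theta> X zs ws \<Longrightarrow> theta_homotopic \<theta> X ws zs"
  by (simp add: theta_homotopic_def equivclp_sym)

lemma theta_homotopic_trans:
  "theta_homotopic \<theta> X zs ws \<Longrightarrow> theta_homotopic \<theta> X ws us \<Longrightarrow> theta_homotopic \<theta> X zs us"
  unfolding theta_homotopic_def by (rule equivclp_trans)

lemma theta_step_imp_homotopic: "theta_step \<theta> X zs ws \<Longrightarrow> theta_homotopic \<theta> X zs ws"
  unfolding theta_homotopic_def by (simp add: r_into_equivclp)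

lemma equiv_theta_loop_rel: "equiv (theta_loops \<theta> X x0) (theta_loop_rel \<theta> X x0)"
proof (rule equivI)
  show "theta_loop_rel \<theta> X x0 \<subseteq> theta_loops \<theta> X x0 \<times> theta_loops \<theta> X x0"
    by (auto simp: theta_loop_rel_def)
  show "refl_on (theta_loops \<theta> X x0) (theta_loop_rel \<theta> X x0)"
    by (auto simp: refl_on_def theta_loop_rel_def)
  show "sym (theta_loop_rel \<theta> X x0)"
    by (auto simp: sym_def theta_loop_rel_def intro: theta_homotopic_sym)
  show "trans (theta_loop_rel \<theta> X x0)"
    by (auto simp: trans_def theta_loop_rel_def intro: theta_homotopic_trans)
qed

lemma lazification_ends:
  assumes "lazification zs ws" "zs \<noteq> []"
  shows "hd ws = hd zs" "last ws = last zs"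
proof -
  obtain f where mono: "mono_on {..<length ws} f" and im: "f ` {..<length ws} = {..<length zs}"
    and f: "\<And>i. i < length ws \<Longrightarrow> ws ! i = zs ! f i" and len: "length zs < length ws"
    using assms(1) unfolding lazification_def by blast
  have "0 \<in> f ` {..<length ws}" "length zs - 1 \<in> f ` {..<length ws}"
    unfolding im using assms(2) by auto
  then obtain a b where a: "a < length ws" "f a = 0" and b: "b < length ws" "f b = length zs - 1"
    by auto
  have "f 0 \<le> f a"
    by (rule mono_onD[OF mono]) (use a in auto)
  moreover have "f b \<le> f (length ws - 1)"
    by (rule mono_onD[OF mono]) (use b in auto)
  moreover have "f (length ws - 1) < length zs"
    using im len by (metis diff_less gr_implies_not0 image_eqI lessThan_iff not_gr_zero zero_less_one)
  ultimately have "f 0 = 0" "f (length ws - 1) = length zs - 1"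
    using a b by auto
  then show "hd ws = hd zs" "last ws = last zs"
    using f[of 0] f[of "length ws - 1"] len assms(2)
    by (cases "ws = []"; simp add: hd_conv_nth last_conv_nth)+
qed

lemma theta_step_ends:
  assumes "theta_step \<theta> X zs ws"
  shows "hd ws = hd zs" "last ws = last zs"
proof -
  have ne: "zs \<noteq> []" "ws \<noteq> []"
    using assms by (auto simp: theta_step_def theta_path_def)
  have "hd ws = hd zs \<and> last ws = last zs"
  proof (cases "lazification zs ws")
    case True
    then show ?thesis using lazification_ends ne by blast
  next
    case False
    then have "theta_grid_homotopic \<theta> X zs ws"
      using assms by (simp add: theta_step_def)
    then obtain n and m :: nat and H where "length zs = Suc n" "length ws = Suc n"
      and "\<forall>j\<le>m. H 0 j = zs ! 0 \<and> H 0 j = ws ! 0 \<and> H n j = zs ! n \<and> H n j = ws ! n"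
      unfolding theta_grid_homotopic_def by blast
    moreover from this(3) have "ws ! 0 = zs ! 0" "ws ! n = zs ! n"
      by (auto dest: spec[of _ 0])
    ultimately show ?thesis
      using ne by (simp add: hd_conv_nth last_conv_nth)
  qed
  then show "hd ws = hd zs" "last ws = last zs" by auto
qed

lemma lazification_append:
  assumes "lazification zs ws"
  shows "lazification (us @ zs @ vs) (us @ ws @ vs)"
proof -
  obtain f where mono: "mono_on {..<length ws} f" and im: "f ` {..<length ws} = {..<length zs}"
    and f: "\<And>i. i < length ws \<Longrightarrow> ws ! i = zs ! f i" and len: "length zs < length ws"
    using assms(1) unfolding lazification_def by blast
  have fl: "f i < length zs" if "i < length ws" for i
    using im that by auto
  define k where "k = length us"
  define g where "g = (\<lambda>i. if i < k then i else if i < k + length ws then k + f (i - k)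
                            else i - length ws + length zs)"
  have "mono_on {..<length (us @ ws @ vs)} g"
  proof (rule mono_onI)
    fix i j assume "i \<in> {..<length (us @ ws @ vs)}" "j \<in> {..<length (us @ ws @ vs)}" "i \<le> j"
    moreover have "f (i - k) \<le> f (j - k)" if "k \<le> i" "j < k + length ws" "i \<le> j"
      using that by (intro mono_onD[OF mono]) auto
    ultimately show "g i \<le> g j"
      using fl[of "i - k"] len unfolding g_def by fastforce
  qed
  moreover have "g ` {..<length (us @ ws @ vs)} = {..<length (us @ zs @ vs)}"
  proof (intro equalityI subsetI)
    fix j assume "j \<in> g ` {..<length (us @ ws @ vs)}"
    then obtain i where "i < length (us @ ws @ vs)" "j = g i" by auto
    then show "j \<in> {..<length (us @ zs @ vs)}"
      using fl[of "i - k"] len unfolding g_def k_def by (fastforce split: if_splits)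
  next
    fix j assume j: "j \<in> {..<length (us @ zs @ vs)}"
    consider "j < k" | "k \<le> j" "j < k + length zs" | "k + length zs \<le> j" by linarith
    then show "j \<in> g ` {..<length (us @ ws @ vs)}"
    proof cases
      case 1
      then show ?thesis by (intro image_eqI[of _ _ j]) (auto simp: g_def k_def)
    next
      case 2
      then have "j - k \<in> f ` {..<length ws}" unfolding im by auto
      then obtain i where "i < length ws" "f i = j - k" by auto
      with 2 show ?thesis by (intro image_eqI[of _ _ "k + i"]) (auto simp: g_def k_def)
    next
      case 3
      with j show ?thesis
        by (intro image_eqI[of _ _ "j - length zs + length ws"]) (auto simp: g_def k_def)
    qed
  qed
  moreover have "(us @ ws @ vs) ! i = (us @ zs @ vs) ! g i" if "i < length (us @ ws @ vs)" for i
  proof -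
    consider "i < k" | "k \<le> i" "i < k + length ws" | "k + length ws \<le> i" by linarith
    then show ?thesis
    proof cases
      case 2
      then have "i - k < length ws" by linarith
      with 2 f[of "i - k"] fl[of "i - k"] show ?thesis
        by (simp add: nth_append g_def k_def)
    qed (auto simp: nth_append g_def k_def add.commute)
  qed
  ultimately show ?thesis
    unfolding lazification_def using len by (intro conjI exI[of _ g]) auto
qed

lemma theta_path_nth:
  "theta_path \<theta> X zs \<longleftrightarrow> zs \<noteq> [] \<and> (\<forall>i<length zs. zs ! i \<in> X) \<and>
     (\<forall>i. Suc i < length zs \<longrightarrow> dist (zs ! i) (zs ! Suc i) \<le> \<theta>)"
  by (auto simp: theta_path_def successively_conv_nth subset_iff in_set_conv_nth)

lemma theta_path_append_swap:
  assumes "theta_path \<theta> X (us @ zs @ vs)" "theta_path \<theta> X ws" "hd ws = hd zs" "last ws = last zs" "zs \<noteq> []"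
  shows "theta_path \<theta> X (us @ ws @ vs)"
  using assms by (auto simp: theta_path_def successively_append_iff)

lemma theta_grid_homotopic_append:
  assumes grid: "theta_grid_homotopic \<theta> X zs ws" and "theta_path \<theta> X (us @ zs @ vs)" "\<theta> > 0"
  shows "theta_grid_homotopic \<theta> X (us @ zs @ vs) (us @ ws @ vs)"
proof -
  obtain n m H where len: "length zs = Suc n" "length ws = Suc n"
    and X: "\<And>i j. i \<le> n \<Longrightarrow> j \<le> m \<Longrightarrow> H i j \<in> X"
    and lip: "\<And>i j i' j'. i \<le> n \<Longrightarrow> j \<le> m \<Longrightarrow> i' \<le> n \<Longrightarrow> j' \<le> m \<Longrightarrow>
           dist (H i j) (H i' j') \<le> \<theta> * (\<bar>real i - real i'\<bar> + \<bar>real j - real j'\<bar>)"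
    and H: "\<And>i. i \<le> n \<Longrightarrow> H i 0 = zs ! i" "\<And>i. i \<le> n \<Longrightarrow> H i m = ws ! i"
           "\<And>j. j \<le> m \<Longrightarrow> H 0 j = zs ! 0" "\<And>j. j \<le> m \<Longrightarrow> H n j = zs ! n"
  proof -
    from grid obtain n m H where "length zs = Suc n" "length ws = Suc n"
      "\<forall>i\<le>n. \<forall>j\<le>m. H i j \<in> X"
      "\<forall>i\<le>n. \<forall>j\<le>m. \<forall>i'\<le>n. \<forall>j'\<le>m.
           dist (H i j) (H i' j') \<le> \<theta> * (\<bar>real i - real i'\<bar> + \<bar>real j - real j'\<bar>)"
      "\<forall>i\<le>n. H i 0 = zs ! i \<and> H i m = ws ! i"
      "\<forall>j\<le>m. H 0 j = zs ! 0 \<and> H 0 j = ws ! 0 \<and> H n j = zs ! n \<and> H n j = ws ! n"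
      unfolding theta_grid_homotopic_def by blast
    then show ?thesis
      by (intro that[of n m H]) blast+
  qed
  define k where "k = length us"
  define P where "P = us @ zs @ vs"
  define G where "G = (\<lambda>i j. if k \<le> i \<and> i \<le> k + n then H (i - k) j else P ! i)"
  have P: "\<And>i. i < length P \<Longrightarrow> P ! i \<in> X"
      "\<And>i. Suc i < length P \<Longrightarrow> dist (P ! i) (P ! Suc i) \<le> \<theta>"
    using assms(2) by (auto simp: theta_path_nth P_def)
  have lenP: "length P = k + Suc n + length vs"
    using len by (simp add: P_def k_def)
  have mid: "P ! i = zs ! (i - k)" if "k \<le> i" "i \<le> k + n" for i
    using that len by (auto simp: P_def k_def nth_append)
  show ?thesis
    unfolding P_def[symmetric]
  proof (rule grid_homotopicI[where H = G and n = "length P - 1" and m = m])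
    show "length P = Suc (length P - 1)" "length (us @ ws @ vs) = Suc (length P - 1)"
      using len lenP by (auto simp: k_def)
    show "G i j \<in> X" if "i \<le> length P - 1" "j \<le> m" for i j
      using that X[of "i - k" j] P(1)[of i] lenP by (auto simp: G_def)
    show "dist (G i j) (G (Suc i) j) \<le> \<theta>" if "i < length P - 1" "j \<le> m" for i j
    proof -
      have Suci: "Suc i < length P" using that by linarith
      consider "k \<le> i" "Suc i \<le> k + n" | "Suc i = k" | "i = k + n" | "Suc i < k" | "k + n < i"
        by linarith
      then show ?thesis
      proof cases
        case 1
        then have "Suc i - k = Suc (i - k)" "i - k < n" by auto
        with 1 lip[of "i - k" j "Suc (i - k)" j] that show ?thesis
          by (simp add: G_def)
      next
        case 2
        then show ?thesis
          using P(2)[OF Suci] mid[of k] H(3)[of j] that by (auto simp: G_def)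
      next
        case 3
        then show ?thesis
          using P(2)[OF Suci] mid[of "k + n"] H(4)[of j] that by (auto simp: G_def)
      qed (use P(2)[OF Suci] in \<open>auto simp: G_def\<close>)
    qed
    show "dist (G i j) (G i (Suc j)) \<le> \<theta>" if "i \<le> length P - 1" "j < m" for i j
      using lip[of "i - k" j "i - k" "Suc j"] that \<open>\<theta> > 0\<close> by (auto simp: G_def)
    show "G i 0 = P ! i" if "i \<le> length P - 1" for i
      using that H(1)[of "i - k"] mid[of i] by (auto simp: G_def)
    show "G i m = (us @ ws @ vs) ! i" if "i \<le> length P - 1" for i
      using that H(2)[of "i - k"] len by (auto simp: G_def P_def nth_append k_def)
    show "G 0 j = P ! 0" if "j \<le> m" for j
      using that H(3)[of j] mid[of 0] by (auto simp: G_def)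
    show "G (length P - 1) j = P ! (length P - 1)" if "j \<le> m" for j
      using that H(4)[of j] mid[of "k + n"] lenP by (cases vs) (auto simp: G_def)
  qed
qed

lemma theta_homotopic_append:
  assumes "theta_homotopic \<theta> X zs ws" "theta_path \<theta> X (us @ zs @ vs)" "zs \<noteq> []" "\<theta> > 0"
  shows "theta_homotopic \<theta> X (us @ zs @ vs) (us @ ws @ vs)"
proof -
  have lift: "theta_step \<theta> X (us @ ys @ vs) (us @ ws @ vs)"
    if "theta_step \<theta> X ys ws" "theta_path \<theta> X (us @ ys @ vs)" "theta_path \<theta> X (us @ ws @ vs)" for ys ws
    using that lazification_append theta_grid_homotopic_append \<open>\<theta> > 0\<close>
    unfolding theta_step_def by blast
  have "theta_homotopic \<theta> X (us @ zs @ vs) (us @ ws @ vs) \<and> theta_path \<theta> X (us @ ws @ vs) \<and> ws \<noteq> []"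
    using assms(1) unfolding theta_homotopic_def
  proof (induction rule: equivclp_induct)
    case base
    then show ?case using assms by simp
  next
    case (step y z)
    have yz: "theta_path \<theta> X y" "theta_path \<theta> X z" "hd z = hd y" "last z = last y" "z \<noteq> []"
    proof -
      show "hd z = hd y" "last z = last y"
        using step.hyps(2) theta_step_ends by metis+
      show "theta_path \<theta> X y" "theta_path \<theta> X z" "z \<noteq> []"
        using step.hyps(2) by (auto simp: theta_step_def theta_path_def)
    qed
    have p: "theta_path \<theta> X (us @ z @ vs)"
      using theta_path_append_swap[of \<theta> X us y vs z] yz step.IH by blast
    have "theta_step \<theta> X (us @ y @ vs) (us @ z @ vs) \<or> theta_step \<theta> X (us @ z @ vs) (us @ y @ vs)"
      using lift[of y z] lift[of z y] step p by blast
    then show ?case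
      using step.IH p yz by (meson equivclp_into_equivclp)
  qed
  then show ?thesis ..
qed

lemma theta_loops_concat:
  assumes "zs \<in> theta_loops \<theta> X x0" "ws \<in> theta_loops \<theta> X x0"
  shows "zs @ tl ws \<in> theta_loops \<theta> X x0"
proof -
  obtain us where ws: "ws = x0 # us"
    using assms(2) by (cases ws) (auto simp: theta_loops_def theta_path_def)
  show ?thesis
  proof (cases us)
    case Nil
    with assms ws show ?thesis by simp
  next
    case (Cons u us')
    with assms ws show ?thesis
      by (simp add: theta_loops_def theta_path_def successively_append_iff)
  qed
qed

lemma concat_eq_butlast:
  assumes "zs \<in> theta_loops \<theta> X x0" "ws \<in> theta_loops \<theta> X x0"
  shows "zs @ tl ws = butlast zs @ ws"
proof -
  have "zs = butlast zs @ [x0]" "ws = x0 # tl ws"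
    using assms by (auto simp: theta_loops_def theta_path_def) (metis append_butlast_last_id, metis list.collapse)
  then show ?thesis by (metis append.assoc append_Cons append_Nil)
qed

lemma theta_homotopic_rev_concat:
  assumes zs: "zs \<in> theta_loops \<theta> X x0" and "\<theta> > 0"
  shows "theta_homotopic \<theta> X (zs @ tl (rev zs)) [x0]"
proof (cases "length zs = 1")
  case True
  then have "zs = [x0]"
    using zs by (auto simp: theta_loops_def length_Suc_conv)
  then show ?thesis by simp
next
  case False
  define n where "n = length zs - 1"
  have ne: "zs \<noteq> []" using zs by (auto simp: theta_loops_def theta_path_def)
  then have n: "length zs = Suc n" "n > 0"
    using False by (cases zs; auto simp: n_def)+
  have z: "\<And>i. i \<le> n \<Longrightarrow> zs ! i \<in> X" "\<And>i. i < n \<Longrightarrow> dist (zs ! i) (zs ! Suc i) \<le> \<theta>" "zs ! 0 = x0"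
    using zs n by (auto simp: theta_loops_def theta_path_nth hd_conv_nth)
  have near: "dist (zs ! a) (zs ! b) \<le> \<theta>" if "a \<le> n" "b \<le> n" "a = b \<or> a = Suc b \<or> b = Suc a" for a b
    using that z(2)[of a] z(2)[of b] \<open>\<theta> > 0\<close> by (auto simp: dist_commute)
  have loop: "zs @ tl (rev zs) \<in> theta_loops \<theta> X x0"
  proof (rule theta_loops_concat[OF zs])
    show "rev zs \<in> theta_loops \<theta> X x0"
      using zs by (auto simp: theta_loops_def theta_path_def hd_rev last_rev dist_commute)
  qed
  define W where "W = zs @ tl (rev zs)"
  have W: "W ! i = zs ! min i (2 * n - i)" if "i \<le> 2 * n" for i
    using that n by (auto simp: W_def nth_append nth_tl rev_nth intro!: arg_cong[of _ _ "nth zs"])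
  have "theta_grid_homotopic \<theta> X W (replicate (Suc (2 * n)) x0)"
  proof (rule grid_homotopicI[where n = "2 * n" and m = n
        and H = "\<lambda>i t. zs ! min (min i (2 * n - i)) (n - t)"])
    show "length W = Suc (2 * n)" using n by (simp add: W_def)
    show "zs ! min (min i (2 * n - i)) (n - t) \<in> X" if "i \<le> 2 * n" for i t
      by (rule z(1)) linarith
    show "dist (zs ! min (min i (2 * n - i)) (n - t)) (zs ! min (min (Suc i) (2 * n - Suc i)) (n - t)) \<le> \<theta>"
      if "i < 2 * n" for i t
      by (rule near) (use that in linarith)+
    show "dist (zs ! min (min i (2 * n - i)) (n - t)) (zs ! min (min i (2 * n - i)) (n - Suc t)) \<le> \<theta>"
      for i t
      by (rule near) linarith+
    show "zs ! min (min i (2 * n - i)) (n - 0) = W ! i" if "i \<le> 2 * n" for i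
      unfolding W[OF that] by (rule arg_cong[of _ _ "nth zs"]) linarith
  qed (use z(3) W[of 0] W[of "2 * n"] in \<open>auto simp del: replicate_Suc\<close>)
  moreover have "theta_path \<theta> X (replicate (Suc (2 * n)) x0)" "theta_path \<theta> X [x0]"
    using z(1)[of 0] z(3) \<open>\<theta> > 0\<close> by (auto simp: theta_path_nth nth_Cons')
  moreover have "lazification [x0] (replicate (Suc (2 * n)) x0)"
    unfolding lazification_def using n(2)
    by (auto intro!: exI[of _ "\<lambda>_. 0"] mono_onI simp del: replicate_Suc)
  moreover have "theta_path \<theta> X W"
    using loop by (simp add: W_def theta_loops_def)
  ultimately have "theta_step \<theta> X W (replicate (Suc (2 * n)) x0)"
      "theta_step \<theta> X [x0] (replicate (Suc (2 * n)) x0)"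
    by (auto simp: theta_step_def)
  then show ?thesis
    unfolding W_def by (meson theta_homotopic_sym theta_homotopic_trans theta_step_imp_homotopic)
qed

lemma theta_loop_rel_concat:
  assumes "\<theta> > 0" "(p, p') \<in> theta_loop_rel \<theta> X x0" "(q, q') \<in> theta_loop_rel \<theta> X x0"
  shows "(p @ tl q, p' @ tl q') \<in> theta_loop_rel \<theta> X x0"
proof -
  have L: "p \<in> theta_loops \<theta> X x0" "p' \<in> theta_loops \<theta> X x0" "q \<in> theta_loops \<theta> X x0" "q' \<in> theta_loops \<theta> X x0"
    and h: "theta_homotopic \<theta> X p p'" "theta_homotopic \<theta> X q q'"
    using assms by (auto simp: theta_loop_rel_def)
  note paths = theta_loops_concat[OF L(1) L(3)] theta_loops_concat[OF L(2) L(3)]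
  have "theta_homotopic \<theta> X ([] @ p @ tl q) ([] @ p' @ tl q)"
    by (rule theta_homotopic_append) (use h L paths assms in \<open>auto simp: theta_loops_def theta_path_def\<close>)
  moreover have "theta_homotopic \<theta> X (butlast p' @ q @ []) (butlast p' @ q' @ [])"
    by (rule theta_homotopic_append)
      (use h L paths assms concat_eq_butlast[OF L(2) L(3)] in \<open>auto simp: theta_loops_def theta_path_def\<close>)
  ultimately have "theta_homotopic \<theta> X (p @ tl q) (p' @ tl q')"
    using concat_eq_butlast[OF L(2) L(3)] concat_eq_butlast[OF L(2) L(4)]
    by (auto intro: theta_homotopic_trans)
  then show ?thesis
    using L by (simp add: theta_loop_rel_def theta_loops_concat)
qed

lemma group_discrete_fundamental_group:
  assumes "x0 \<in> X" "\<theta> > 0"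
  shows "group (discrete_fundamental_group \<theta> X x0)"
  unfolding discrete_fundamental_group_def
proof (rule group_class_group[OF equiv_theta_loop_rel])
  show "(p @ tl q, p' @ tl q') \<in> theta_loop_rel \<theta> X x0"
    if "(p, p') \<in> theta_loop_rel \<theta> X x0" "(q, q') \<in> theta_loop_rel \<theta> X x0" for p p' q q'
    using assms(2) that by (rule theta_loop_rel_concat)
  have one: "[x0] \<in> theta_loops \<theta> X x0"
    using assms by (simp add: theta_loops_def theta_path_def)
  then show "[x0] \<in> theta_loops \<theta> X x0" .
  show "p @ tl q \<in> theta_loops \<theta> X x0" if "p \<in> theta_loops \<theta> X x0" "q \<in> theta_loops \<theta> X x0" for p q
    using that by (rule theta_loops_concat)
  show "((p @ tl q) @ tl s, p @ tl (q @ tl s)) \<in> theta_loop_rel \<theta> X x0"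
    if "p \<in> theta_loops \<theta> X x0" "q \<in> theta_loops \<theta> X x0" "s \<in> theta_loops \<theta> X x0" for p q s
  proof -
    have "q \<noteq> []" using that by (auto simp: theta_loops_def theta_path_def)
    then have "(p @ tl q) @ tl s = p @ tl (q @ tl s)" by simp
    moreover have "p @ tl (q @ tl s) \<in> theta_loops \<theta> X x0"
      using that by (simp add: theta_loops_concat)
    ultimately show ?thesis by (simp add: theta_loop_rel_def)
  qed
  show "([x0] @ tl p, p) \<in> theta_loop_rel \<theta> X x0" if p: "p \<in> theta_loops \<theta> X x0" for p
  proof -
    have "[x0] @ tl p = p"
      using p by (auto simp: theta_loops_def theta_path_def)
    then show ?thesis using p by (simp add: theta_loop_rel_def)
  qed
  show "\<exists>q\<in>theta_loops \<theta> X x0. (q @ tl p, [x0]) \<in> theta_loop_rel \<theta> X x0"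
    if p: "p \<in> theta_loops \<theta> X x0" for p
  proof
    show q: "rev p \<in> theta_loops \<theta> X x0"
      using p by (auto simp: theta_loops_def theta_path_def hd_rev last_rev dist_commute)
    show "(rev p @ tl p, [x0]) \<in> theta_loop_rel \<theta> X x0"
      using theta_homotopic_rev_concat[OF q assms(2)] theta_loops_concat[OF q p] one
      by (simp add: theta_loop_rel_def)
  qed
qed


section \<open>The inverse limit over all scales\<close>

definition scale_map :: "real \<Rightarrow> 'a::metric_space set \<Rightarrow> 'a \<Rightarrow> 'a list set \<Rightarrow> 'a list set" where
  "scale_map \<theta> X x0 P = theta_loop_rel \<theta> X x0 `` P"

definition discrete_limit_group :: "'a::metric_space set \<Rightarrow> 'a \<Rightarrow> (real \<Rightarrow> 'a list set) monoid" where
  "discrete_limit_group X x0 =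
     (product_group {0<..} (\<lambda>\<theta>. discrete_fundamental_group \<theta> X x0))
       \<lparr>carrier := {c \<in> \<Pi>\<^sub>E \<theta>\<in>{0<..}. carrier (discrete_fundamental_group \<theta> X x0).
                    \<forall>\<theta>' \<theta>. 0 < \<theta>' \<and> \<theta>' \<le> \<theta> \<longrightarrow> scale_map \<theta> X x0 (c \<theta>') = c \<theta>}\<rparr>"

lemma theta_step_mono:
  assumes "theta_step \<theta>' X zs ws" "\<theta>' \<le> \<theta>"
  shows "theta_step \<theta> X zs ws"
proof -
  have "theta_path \<theta> X us" if "theta_path \<theta>' X us" for us
    using that assms(2) by (force simp: theta_path_nth)
  moreover have "theta_grid_homotopic \<theta> X zs ws" if "theta_grid_homotopic \<theta>' X zs ws"
  proof -
    have *: "\<theta>' * (\<bar>a\<bar> + \<bar>b\<bar>) \<le> \<theta> * (\<bar>a\<bar> + \<bar>b\<bar>)" for a b :: real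
      using assms(2) by (intro mult_right_mono) auto
    show ?thesis
      using that unfolding theta_grid_homotopic_def
      by (elim ex_forward conj_forward) (auto intro: order_trans[OF _ *])
  qed
  ultimately show ?thesis
    using assms(1) by (auto simp: theta_step_def)
qed

lemma theta_loop_rel_mono:
  assumes "\<theta>' \<le> \<theta>"
  shows "theta_loop_rel \<theta>' X x0 \<subseteq> theta_loop_rel \<theta> X x0" "theta_loops \<theta>' X x0 \<subseteq> theta_loops \<theta> X x0"
proof -
  have "theta_homotopic \<theta> X zs ws" if "theta_homotopic \<theta>' X zs ws" for zs ws
    using that unfolding theta_homotopic_def
  proof (induction rule: equivclp_induct)
    case (step y z)
    then show ?case
      using theta_step_mono[OF _ assms] by (meson equivclp_into_equivclp)
  qed simp
  moreover show "theta_loops \<theta>' X x0 \<subseteq> theta_loops \<theta> X x0"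
    using assms by (force simp: theta_loops_def theta_path_nth)
  ultimately show "theta_loop_rel \<theta>' X x0 \<subseteq> theta_loop_rel \<theta> X x0"
    by (auto simp: theta_loop_rel_def)
qed

lemma scale_map_class:
  assumes "\<theta>' \<le> \<theta>" "zs \<in> theta_loops \<theta>' X x0"
  shows "scale_map \<theta> X x0 (theta_loop_rel \<theta>' X x0 `` {zs}) = theta_loop_rel \<theta> X x0 `` {zs}"
proof -
  have "(zs, zs) \<in> theta_loop_rel \<theta>' X x0"
    using assms by (simp add: theta_loop_rel_def)
  moreover have "trans (theta_loop_rel \<theta> X x0)"
    using equiv_theta_loop_rel by (rule equivE)
  ultimately show ?thesis
    using theta_loop_rel_mono(1)[OF assms(1), of X x0] unfolding scale_map_def trans_def by blast
qed

lemma scale_map_hom: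
  assumes "0 < \<theta>'" "\<theta>' \<le> \<theta>"
  shows "scale_map \<theta> X x0 \<in> hom (discrete_fundamental_group \<theta>' X x0) (discrete_fundamental_group \<theta> X x0)"
proof (rule homI)
  let ?G = "\<lambda>\<theta>. discrete_fundamental_group \<theta> X x0"
  have carr: "carrier (?G \<theta>) = theta_loops \<theta> X x0 // theta_loop_rel \<theta> X x0" for \<theta>
    by (simp add: discrete_fundamental_group_def class_group_def)
  have mult: "theta_loop_rel \<theta> X x0 `` {p} \<otimes>\<^bsub>?G \<theta>\<^esub> theta_loop_rel \<theta> X x0 `` {q}
      = theta_loop_rel \<theta> X x0 `` {p @ tl q}"
    if "\<theta> > 0" "p \<in> theta_loops \<theta> X x0" "q \<in> theta_loops \<theta> X x0" for \<theta> p q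
    unfolding discrete_fundamental_group_def
    by (rule class_group_mult[OF equiv_theta_loop_rel])
      (use that in \<open>auto intro: theta_loop_rel_concat\<close>)
  note sub = subsetD[OF theta_loop_rel_mono(2)[OF assms(2)]]
  show "scale_map \<theta> X x0 P \<in> carrier (?G \<theta>)" if "P \<in> carrier (?G \<theta>')" for P
    using that unfolding carr
    by (auto elim!: quotientE simp: scale_map_class assms intro!: quotientI sub)
  show "scale_map \<theta> X x0 (P \<otimes>\<^bsub>?G \<theta>'\<^esub> Q) = scale_map \<theta> X x0 P \<otimes>\<^bsub>?G \<theta>\<^esub> scale_map \<theta> X x0 Q"
    if "P \<in> carrier (?G \<theta>')" "Q \<in> carrier (?G \<theta>')" for P Q
    using that assms unfolding carr
    by (auto elim!: quotientE simp: scale_map_class mult sub theta_loops_concat)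
qed

lemma group_discrete_limit_group:
  assumes "x0 \<in> X"
  shows "group (discrete_limit_group X x0)"
proof -
  let ?G = "\<lambda>\<theta>. discrete_fundamental_group \<theta> X x0"
  let ?P = "product_group {0<..} ?G"
  let ?C = "{c \<in> \<Pi>\<^sub>E \<theta>\<in>{0<..}. carrier (?G \<theta>).
               \<forall>\<theta>' \<theta>. 0 < \<theta>' \<and> \<theta>' \<le> \<theta> \<longrightarrow> scale_map \<theta> X x0 (c \<theta>') = c \<theta>}"
  have G: "group (?G \<theta>)" if "\<theta> > 0" for \<theta>
    using that assms by (simp add: group_discrete_fundamental_group)
  then have P: "group ?P" by (intro product_group) simp
  have hom: "group_hom (?G \<theta>') (?G \<theta>) (scale_map \<theta> X x0)" if "0 < \<theta>'" "\<theta>' \<le> \<theta>" for \<theta> \<theta>'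
    using G[of \<theta>] G[of \<theta>'] scale_map_hom[OF that] that
    by (simp add: group_hom_def group_hom_axioms_def)
  have "subgroup ?C ?P"
  proof (rule group.subgroupI[OF P])
    show "?C \<subseteq> carrier ?P" by auto
    have memI: "restrict g {0<..} \<in> ?C"
      if "\<And>\<theta>. \<theta> > 0 \<Longrightarrow> g \<theta> \<in> carrier (?G \<theta>)"
        and "\<And>\<theta> \<theta>'. 0 < \<theta>' \<Longrightarrow> \<theta>' \<le> \<theta> \<Longrightarrow> scale_map \<theta> X x0 (g \<theta>') = g \<theta>" for g
      using that by simp
    have memD: "c \<theta> \<in> carrier (?G \<theta>)" if "c \<in> ?C" "\<theta> > 0" for c \<theta>
      using that by auto
    have compat: "scale_map \<theta> X x0 (c \<theta>') = c \<theta>" if "c \<in> ?C" "0 < \<theta>'" "\<theta>' \<le> \<theta>" for c \<theta> \<theta>'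
      using that by blast
    have "\<one>\<^bsub>?P\<^esub> \<in> ?C"
      unfolding one_product_group
      by (rule memI) (auto simp: G group.is_monoid group_hom.hom_one[OF hom])
    then show "?C \<noteq> {}" by blast
    show "inv\<^bsub>?P\<^esub> c \<in> ?C" if c: "c \<in> ?C" for c
    proof -
      have "inv\<^bsub>?P\<^esub> c = (\<lambda>\<theta>\<in>{0<..}. inv\<^bsub>?G \<theta>\<^esub> c \<theta>)"
        using c G by (intro inv_product_group) auto
      moreover have "(\<lambda>\<theta>\<in>{0<..}. inv\<^bsub>?G \<theta>\<^esub> c \<theta>) \<in> ?C"
      proof (rule memI)
        show "inv\<^bsub>?G \<theta>\<^esub> c \<theta> \<in> carrier (?G \<theta>)" if "\<theta> > 0" for \<theta>
          using group.inv_closed[OF G memD[OF c]] that by blast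
        show "scale_map \<theta> X x0 (inv\<^bsub>?G \<theta>'\<^esub> c \<theta>') = inv\<^bsub>?G \<theta>\<^esub> c \<theta>"
          if "0 < \<theta>'" "\<theta>' \<le> \<theta>" for \<theta> \<theta>'
          unfolding group_hom.hom_inv[OF hom[OF that] memD[OF c that(1)]] compat[OF c that] ..
      qed
      ultimately show ?thesis by (simp only:)
    qed
    show "c \<otimes>\<^bsub>?P\<^esub> d \<in> ?C" if c: "c \<in> ?C" and d: "d \<in> ?C" for c d
      unfolding mult_product_group
    proof (rule memI)
      show "c \<theta> \<otimes>\<^bsub>?G \<theta>\<^esub> d \<theta> \<in> carrier (?G \<theta>)" if "\<theta> > 0" for \<theta>
        using monoid.m_closed[OF group.is_monoid[OF G] memD[OF c] memD[OF d]] that by blast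
      show "scale_map \<theta> X x0 (c \<theta>' \<otimes>\<^bsub>?G \<theta>'\<^esub> d \<theta>') = c \<theta> \<otimes>\<^bsub>?G \<theta>\<^esub> d \<theta>"
        if "0 < \<theta>'" "\<theta>' \<le> \<theta>" for \<theta> \<theta>'
        unfolding group_hom.hom_mult[OF hom[OF that] memD[OF c that(1)] memD[OF d that(1)]]
          compat[OF c that] compat[OF d that] ..
    qed
  qed
  then show ?thesis
    unfolding discrete_limit_group_def using group.subgroup_imp_group[OF P, of ?C] by blast
qed


section \<open>The discretisation homomorphism\<close>

definition theta_discretisation :: "real \<Rightarrow> (real \<Rightarrow> 'a::metric_space) \<Rightarrow> 'a list \<Rightarrow> bool" where
  "theta_discretisation \<theta> \<gamma> zs \<longleftrightarrow>
     (\<exists>n. \<exists>t :: nat \<Rightarrow> real. t 0 = 0 \<and> t n = 1 \<and> (\<forall>i<n. t i \<le> t (Suc i)) \<and>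
        (\<forall>i<n. \<gamma> ` {t i<..<t (Suc i)} \<subseteq> cball (\<gamma> (t i)) \<theta>) \<and>
        zs = map (\<lambda>i. \<gamma> (t i)) [0..<Suc n])"

text \<open>
  The union runs over all discretisations of all loops in the given homotopy class, so the
  value is a single \<open>\<theta>\<close>-homotopy class exactly when the class of the discretisation is
  independent of these choices.
\<close>

definition discretise :: "real \<Rightarrow> 'a::metric_space set \<Rightarrow> 'a \<Rightarrow> (real \<Rightarrow> 'a) set \<Rightarrow> 'a list set" where
  "discretise \<theta> X x0 P =
     (\<Union>\<gamma>\<in>P. \<Union>zs\<in>{zs. theta_discretisation \<theta> \<gamma> zs}. theta_loop_rel \<theta> X x0 `` {zs})"

definition discretisation_hom ::
    "'a::metric_space set \<Rightarrow> 'a \<Rightarrow> (real \<Rightarrow> 'a) set \<Rightarrow> real \<Rightarrow> 'a list set" where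
  "discretisation_hom X x0 P = (\<lambda>\<theta>\<in>{0<..}. discretise \<theta> X x0 P)"

end

theory Submission
  imports Defs
begin

text \<open>
  By compactness there is a single \<open>e > 0\<close> such that any two paths with the same ends inside
  one ball of radius \<open>e\<close> are homotopic in \<open>X\<close>, and for every \<open>r > 0\<close> there is \<open>d > 0\<close> such that
  points at distance at most \<open>d\<close> are joined by a path of radius \<open>r\<close>. For small \<open>d\<close>, joining
  consecutive points of a \<open>d\<close>-path by such short paths turns \<open>d\<close>-homotopic \<open>d\<close>-paths into
  homotopic paths, and recovers a path up to homotopy from any of its \<open>d\<close>-discretisations.
  Hence a single scale \<open>d\<close> already detects homotopy, which gives injectivity. For surjectivity,
  a compatible family \<open>c\<close> comes from the loop \<open>\<gamma>\<close> obtained from \<open>c d\<close>: for each \<open>\<theta>\<close>, a representative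
  of \<open>c d'\<close> with \<open>d'\<close> much smaller than \<open>\<theta>\<close> is, up to repeating its last point, a \<open>\<theta>\<close>-discretisation
  of the loop that joins its points by very short paths, and that loop is homotopic to \<open>\<gamma>\<close>.
\<close>

section \<open>Small paths\<close>

text \<open>The unit interval is convex, so the straight-line homotopy from \<open>f\<close> to
  \<open>g\<close> stays in it, and \<open>p\<close> carries it into \<open>S\<close>. All changes
  of parametrisation below reduce to this.\<close>

lemma homotopic_paths_compose_unit_interval:
  assumes "path p" "path_image p \<subseteq> S" "path f" "path g"
    and "path_image f \<subseteq> {0..1}" "path_image g \<subseteq> {0..1}"
    and "pathstart f = pathstart g" "pathfinish f = pathfinish g"
  shows "homotopic_paths S (p \<circ> f) (p \<circ> g)"
proof (rule homotopic_paths_continuous_image[where S = "{0..1}"])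
  show "homotopic_paths {0..1} f g"
  proof (rule homotopic_paths_linear)
    show "closed_segment (f t) (g t) \<subseteq> {0..1}" if "t \<in> {0..1}" for t
    proof (rule closed_segment_subset)
      show "f t \<in> {0..1}" "g t \<in> {0..1}"
        using assms(5,6) that unfolding path_image_def by blast+
    qed simp
  qed (use assms in auto)
  show "continuous_on {0..1} p" "p \<in> {0..1} \<rightarrow> S"
    using assms by (auto simp: path_def path_image_def)
qed

lemma joinpaths_compose: "(p \<circ> f) +++ (p \<circ> g) = p \<circ> (f +++ g)"
  by (auto simp: joinpaths_def)

lemma path_const [simp]: "path (\<lambda>_. x)" "path_image (\<lambda>_. x) = {x}"
    "pathstart (\<lambda>_. x) = x" "pathfinish (\<lambda>_. x) = x"
  by (auto simp: path_def path_image_def pathstart_def pathfinish_def)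

text \<open>The constant half is \<open>p\<close> after a constant segment at 1, so the whole join
  is a reparametrisation of \<open>p\<close>.\<close>

lemma homotopic_paths_join_const:
  assumes "path p" "path_image p \<subseteq> S" "x = pathfinish p"
  shows "homotopic_paths S (p +++ (\<lambda>_. x)) p"
proof -
  have eq: "p +++ (\<lambda>_. x) = p \<circ> (linepath 0 1 +++ linepath 1 1)"
    using assms by (auto simp: joinpaths_def linepath_def pathfinish_def)
  have "homotopic_paths S (p \<circ> (linepath 0 1 +++ linepath 1 1)) (p \<circ> linepath 0 1)"
    by (rule homotopic_paths_compose_unit_interval)
      (use assms in \<open>auto simp: path_image_join closed_segment_eq_real_ivl\<close>)
  moreover have "p \<circ> linepath 0 1 = p"
    by (auto simp: linepath_def)
  ultimately show ?thesis
    unfolding eq by simp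
qed

lemma homotopic_paths_const_join:
  assumes "path p" "path_image p \<subseteq> S" "x = pathstart p"
  shows "homotopic_paths S ((\<lambda>_. x) +++ p) p"
proof -
  have "p (2 * t - 1) = p ((linepath 0 0 +++ linepath 0 1) t)" if "t > 1/2" for t
    using that by (auto simp: joinpaths_def linepath_def)
  then have eq: "(\<lambda>_. x) +++ p = p \<circ> (linepath 0 0 +++ linepath 0 1)"
    using assms by (auto simp: joinpaths_def linepath_def pathstart_def)
  have "homotopic_paths S (p \<circ> (linepath 0 0 +++ linepath 0 1)) (p \<circ> linepath 0 1)"
    by (rule homotopic_paths_compose_unit_interval)
      (use assms in \<open>auto simp: path_image_join closed_segment_eq_real_ivl\<close>)
  moreover have "p \<circ> linepath 0 1 = p"
    by (auto simp: linepath_def)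
  ultimately show ?thesis
    unfolding eq by simp
qed

text \<open>A null-homotopy of the loop fills a square. Two routes through the square with the same
  ends are homotopic because the square is convex; one route is mapped to \<open>p\<close>, the
  other to \<open>q\<close> preceded by a path that goes out and comes back.\<close>

lemma homotopic_paths_if_loop_null:
  fixes S :: "'a::topological_space set"
  assumes null: "homotopic_loops S (p +++ reversepath q) (\<lambda>_. a)"
    and p: "path p" "path_image p \<subseteq> S" and q: "path q" "path_image q \<subseteq> S"
    and start: "pathstart p = pathstart q" and finish: "pathfinish p = pathfinish q"
  shows "homotopic_paths S p q"
proof -
  let ?Q = "{0..1::real} \<times> {0..1::real}"
  from null obtain h where h: "continuous_on ?Q h" "h \<in> ?Q \<rightarrow> S"
    and h0: "\<And>x. x \<in> {0..1} \<Longrightarrow> h (0, x) = (p +++ reversepath q) x"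
    and h1: "\<And>x. x \<in> {0..1} \<Longrightarrow> h (1, x) = a"
    and ends: "\<And>t. t \<in> {0..1} \<Longrightarrow> h (t, 1) = h (t, 0)"
    unfolding homotopic_loops by (auto simp: pathstart_def pathfinish_def)
  \<comment> \<open>The homotopy of loops is free, so the base point moves; \<open>v\<close> is its
    track.\<close>
  define v where "v = (\<lambda>t. h (t, 0))"
  have v: "path v" "path_image v \<subseteq> S"
    unfolding path_def v_def path_image_def using h
    by (auto intro!: continuous_on_compose2[OF h(1)] continuous_intros)
  \<comment> \<open>Both routes lead from \<open>(0, 0)\<close> to \<open>(0, 1/2)\<close>.
    \<open>A\<close> follows the first half of the edge that carries the loop, where
    \<open>h\<close> is \<open>p\<close>; \<open>B\<close> goes round the other three edges and
    returns along the second half of that edge, where \<open>h\<close> gives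
    \<open>q\<close>.\<close>
  define A where "A = linepath (0::real, 0::real) (0, 1/2)"
  define B where "B = (linepath (0, 0) (1, 0) +++ linepath (1, 0) (1, 1) +++ linepath (1, 1) (0, 1))
                        +++ linepath (0::real, 1::real) (0, 1/2)"
  have conv: "convex ?Q"
    by (simp add: convex_Times)
  have AB: "homotopic_paths ?Q A B"
  proof (rule homotopic_paths_linear)
    have seg: "path_image (linepath a b) \<subseteq> ?Q" if "a \<in> ?Q" "b \<in> ?Q" for a b
      unfolding path_image_linepath by (rule closed_segment_subset[OF that conv])
    have "path_image A \<subseteq> ?Q" "path_image B \<subseteq> ?Q"
      unfolding A_def B_def by (intro subset_path_image_join seg; simp)+
    then show "closed_segment (A t) (B t) \<subseteq> ?Q" if "t \<in> {0..1}" for t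
      using that by (intro closed_segment_subset[OF _ _ conv]) (auto simp: path_image_def)
  qed (auto simp: A_def B_def)
  have "homotopic_paths S (h \<circ> A) (h \<circ> B)"
    by (rule homotopic_paths_continuous_image[OF AB h])
  moreover have "homotopic_paths S p (h \<circ> A)"
    by (rule homotopic_paths_eq[OF p]) (auto simp: A_def linepath_def h0 joinpaths_def)
  \<comment> \<open>On the three edges \<open>h\<close> gives \<open>v\<close>, the constant
    \<open>a = v 1\<close>, and \<open>v\<close> backwards. All of this is \<open>v\<close> after a
    path in the unit interval from 0 to 0, and so contracts.\<close>
  moreover have "homotopic_paths S (h \<circ> B)
       ((v \<circ> (linepath 0 1 +++ linepath 1 1 +++ linepath 1 0)) +++ q)"
  proof (rule homotopic_paths_eq)
    show "path (h \<circ> B)" "path_image (h \<circ> B) \<subseteq> S"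
      using \<open>homotopic_paths S (h \<circ> A) (h \<circ> B)\<close> homotopic_paths_imp_path homotopic_paths_imp_subset
      by blast+
    \<comment> \<open>At \<open>s = 1\<close> the join still takes its value from \<open>p\<close>,
      which is where \<open>finish\<close> enters.\<close>
    have q_half: "h (0, 1 - s / 2) = q s" if "s \<in> {0..1}" for s
      using that finish by (auto simp: h0 joinpaths_def reversepath_def pathfinish_def field_simps)
    show "(h \<circ> B) t = ((v \<circ> (linepath 0 1 +++ linepath 1 1 +++ linepath 1 0)) +++ q) t"
      if t: "t \<in> {0..1}" for t
    proof (cases "t \<le> 1/2")
      case True
      with t show ?thesis
        by (auto simp: B_def joinpaths_def v_def linepath_def h1 ends)
    next
      case False
      have "h (B t) = h (0, 1 - (2 * t - 1) / 2)"
        using False by (simp add: B_def joinpaths_def linepath_def algebra_simps)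
      with False t show ?thesis
        using q_half[of "2 * t - 1"] by (simp add: joinpaths_def)
    qed
  qed
  moreover have "homotopic_paths S ((v \<circ> (linepath 0 1 +++ linepath 1 1 +++ linepath 1 0)) +++ q)
       ((v \<circ> (\<lambda>_. 0)) +++ q)"
  proof (rule homotopic_paths_join)
    show "homotopic_paths S (v \<circ> (linepath 0 1 +++ linepath 1 1 +++ linepath 1 0)) (v \<circ> (\<lambda>_. 0))"
      by (rule homotopic_paths_compose_unit_interval)
        (use v in \<open>auto simp: path_image_join closed_segment_eq_real_ivl\<close>)
    show "homotopic_paths S q q" using q by simp
    show "pathfinish (v \<circ> (linepath 0 1 +++ linepath 1 1 +++ linepath 1 0)) = pathstart q"
      using h0[of 0] start by (simp add: pathfinish_compose v_def) (simp add: joinpaths_def pathstart_def)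
  qed
  moreover have "homotopic_paths S ((v \<circ> (\<lambda>_. 0)) +++ q) q"
  proof -
    have "v \<circ> (\<lambda>_::real. 0) = (\<lambda>_. pathstart q)"
      using h0[of 0] start by (auto simp: v_def joinpaths_def pathstart_def)
    then show ?thesis using homotopic_paths_const_join[OF q refl] by (simp only:)
  qed
  ultimately show ?thesis
    by (meson homotopic_paths_trans)
qed

section \<open>Uniform scales obtained from compactness\<close>

text \<open>A uniform semi-local simple connectedness, phrased for pairs of paths because that is
  the form in which short paths are compared. The homotopy may leave the ball.\<close>

definition homotopy_radius :: "'a::metric_space set \<Rightarrow> real \<Rightarrow> bool" where
  "homotopy_radius X e \<longleftrightarrow> e > 0 \<and>
     (\<forall>x\<in>X. \<forall>p q. path p \<and> path q \<and> path_image p \<subseteq> X \<inter> ball x e \<and> path_image q \<subseteq> X \<inter> ball x e \<and>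
        pathstart p = pathstart q \<and> pathfinish p = pathfinish q \<longrightarrow> homotopic_paths X p q)"

text \<open>A Lebesgue number of the cover by the balls given by semi-local simple connectedness
  works: \<open>p\<close> followed by the reverse of \<open>q\<close> then lies in one ball of the
  cover.\<close>

lemma homotopy_radius_exists:
  assumes "compact X" "semilocally_simply_connected X"
  shows "\<exists>e. homotopy_radius X e"
proof -
  obtain e where e: "\<And>x. x \<in> X \<Longrightarrow> e x > 0"
    and null: "\<And>x p. x \<in> X \<Longrightarrow> path p \<Longrightarrow> path_image p \<subseteq> X \<inter> ball x (e x) \<Longrightarrow>
        pathfinish p = pathstart p \<Longrightarrow> \<exists>a. homotopic_loops X p (\<lambda>_. a)"
    using assms(2) unfolding semilocally_simply_connected_def by metis
  have "X \<subseteq> \<Union>((\<lambda>x. ball x (e x)) ` X)"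
    using e by fastforce
  from Heine_Borel_lemma[OF assms(1) this]
  obtain r where r: "r > 0" "\<And>x. x \<in> X \<Longrightarrow> \<exists>G\<in>(\<lambda>x. ball x (e x)) ` X. ball x r \<subseteq> G"
    by auto
  have "homotopic_paths X p q"
    if x: "x \<in> X" and pq: "path p" "path q" "path_image p \<subseteq> X \<inter> ball x r" "path_image q \<subseteq> X \<inter> ball x r"
      "pathstart p = pathstart q" "pathfinish p = pathfinish q" for x p q
  proof -
    obtain y where y: "y \<in> X" "ball x r \<subseteq> ball y (e y)"
      using r(2)[OF x] by blast
    have "\<exists>a. homotopic_loops X (p +++ reversepath q) (\<lambda>_. a)"
    proof (rule null[OF y(1)])
      show "path_image (p +++ reversepath q) \<subseteq> X \<inter> ball y (e y)"
        using pq y(2) by (intro subset_path_image_join) auto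
    qed (use pq in auto)
    with pq show ?thesis
      by (auto intro: homotopic_paths_if_loop_null)
  qed
  with r(1) show ?thesis
    unfolding homotopy_radius_def by blast
qed

text \<open>\<open>s\<close> is a fixed choice of short paths. Nothing forces \<open>s x x\<close>
  to be constant: it is a small loop that has to be contracted wherever it occurs.\<close>

definition connector :: "'a::metric_space set \<Rightarrow> real \<Rightarrow> real \<Rightarrow> ('a \<Rightarrow> 'a \<Rightarrow> real \<Rightarrow> 'a) \<Rightarrow> bool" where
  "connector X d r s \<longleftrightarrow> (\<forall>x\<in>X. \<forall>y\<in>X. dist x y \<le> d \<longrightarrow>
     path (s x y) \<and> path_image (s x y) \<subseteq> X \<inter> ball x r \<and> pathstart (s x y) = x \<and> pathfinish (s x y) = y)"

text \<open>Cover \<open>X\<close> by open sets whose points are joined inside a ball of radius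
  \<open>r/2\<close>. Points at distance at most half a Lebesgue number lie in a common member of
  the cover; halving accounts for the balls being open.\<close>

lemma connector_exists:
  assumes "compact X" "locally path_connected X" "r > 0"
  shows "\<exists>d s. d > 0 \<and> connector X d r s"
proof -
  have "\<exists>O'. open O' \<and> x \<in> O' \<and> (\<forall>a\<in>X \<inter> O'. \<forall>b\<in>X \<inter> O'.
          \<exists>p. path p \<and> path_image p \<subseteq> X \<inter> ball x (r/2) \<and> pathstart p = a \<and> pathfinish p = b)"
    if "x \<in> X" for x
  proof -
    have "openin (top_of_set X) (X \<inter> ball x (r/2)) \<and> x \<in> X \<inter> ball x (r/2)"
      using that assms(3) by auto
    with assms(2) that obtain V where V: "openin (top_of_set X) V" "x \<in> V"
      "\<forall>a\<in>V. \<forall>b\<in>V. \<exists>p. path p \<and> path_image p \<subseteq> X \<inter> ball x (r/2) \<and> pathstart p = a \<and> pathfinish p = b"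
      unfolding locally_path_connected_iff_joined_in_larger by meson
    then show ?thesis
      by (metis openin_open IntD2)
  qed
  then obtain W where W: "\<And>x. x \<in> X \<Longrightarrow> open (W x)" "\<And>x. x \<in> X \<Longrightarrow> x \<in> W x"
    and J: "\<And>x a b. x \<in> X \<Longrightarrow> a \<in> X \<inter> W x \<Longrightarrow> b \<in> X \<inter> W x \<Longrightarrow>
       \<exists>p. path p \<and> path_image p \<subseteq> X \<inter> ball x (r/2) \<and> pathstart p = a \<and> pathfinish p = b"
    by metis
  have "X \<subseteq> \<Union>(W ` X)"
    using W by blast
  from Heine_Borel_lemma[OF assms(1) this]
  obtain e where e: "e > 0" "\<And>x. x \<in> X \<Longrightarrow> \<exists>G\<in>W ` X. ball x e \<subseteq> G"
    using W(1) by auto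
  have "\<exists>p. path p \<and> path_image p \<subseteq> X \<inter> ball a r \<and> pathstart p = a \<and> pathfinish p = b"
    if ab: "a \<in> X" "b \<in> X" "dist a b \<le> e/2" for a b
  proof -
    obtain x where x: "x \<in> X" "ball a e \<subseteq> W x"
      using e(2)[OF ab(1)] by blast
    have "a \<in> ball a e" "b \<in> ball a e"
      using ab e(1) by auto
    then have "a \<in> X \<inter> W x" "b \<in> X \<inter> W x"
      using x(2) ab by auto
    from J[OF x(1) this] obtain p
      where p: "path p" "path_image p \<subseteq> X \<inter> ball x (r/2)" "pathstart p = a" "pathfinish p = b"
      by blast
    \<comment> \<open>The path lies around \<open>x\<close>, but \<open>connector\<close> measures
      from its starting point; moving the centre from \<open>x\<close> to \<open>a\<close> costs
      another \<open>r/2\<close>.\<close>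
    have "a \<in> ball x (r/2)"
      using p pathstart_in_path_image[of p] by auto
    then have "ball x (r/2) \<subseteq> ball a r"
      using dist_triangle3[of a _ x] by (force intro: le_less_trans)
    with p show ?thesis by blast
  qed
  then obtain s where "connector X (e/2) r s"
    unfolding connector_def by metis
  with e(1) show ?thesis
    by (intro exI[of _ "e/2"]) auto
qed

section \<open>Paths through the points of a discrete path\<close>

text \<open>The empty list is left out because discrete paths are non-empty. Every chain ends with a
  constant piece, which later shows up as a repeated last point.\<close>

fun chain_path :: "('a \<Rightarrow> 'a \<Rightarrow> real \<Rightarrow> 'a::topological_space) \<Rightarrow> 'a list \<Rightarrow> real \<Rightarrow> 'a" where
  "chain_path s [x] = (\<lambda>_. x)"
| "chain_path s (x # y # zs) = s x y +++ chain_path s (y # zs)"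

lemma theta_path_simps [simp]:
  "\<not> theta_path \<theta> X []"
  "theta_path \<theta> X [x] \<longleftrightarrow> x \<in> X"
  "theta_path \<theta> X (x # y # zs) \<longleftrightarrow> x \<in> X \<and> dist x y \<le> \<theta> \<and> theta_path \<theta> X (y # zs)"
  by (auto simp: theta_path_def)

lemma theta_path_hd: "theta_path \<theta> X (x # zs) \<Longrightarrow> x \<in> X"
  by (simp add: theta_path_def)

lemma theta_path_mono: "theta_path \<theta> X zs \<Longrightarrow> \<theta> \<le> \<theta>' \<Longrightarrow> theta_path \<theta>' X zs"
  by (force simp: theta_path_nth)

section \<open>Lazifications and the times of a discretisation\<close>

text \<open>A lazification only repeats points consecutively, so collapsing adjacent repetitions
  forgets it. The collapsing map of \<open>ws\<close> is \<open>f\<close> followed by the collapsing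
  map \<open>g\<close> of \<open>zs\<close>.\<close>

lemma lazification_remdups_adj:
  assumes "lazification zs ws"
  shows "remdups_adj ws = remdups_adj zs"
proof -
  obtain f where mono: "mono_on {..<length ws} f" and im: "f ` {..<length ws} = {..<length zs}"
    and f: "\<And>i. i < length ws \<Longrightarrow> ws ! i = zs ! f i" and len: "length zs < length ws"
    using assms unfolding lazification_def by blast
  obtain g where g: "mono g" "g ` {0..<length zs} = {0..<length (remdups_adj zs)}"
    "\<And>i. i < length zs \<Longrightarrow> zs ! i = remdups_adj zs ! g i"
    "\<And>i. Suc i < length zs \<Longrightarrow> zs ! i = zs ! Suc i \<longleftrightarrow> g i = g (Suc i)"
    using remdups_adj_altdef[of zs "remdups_adj zs"] by auto
  \<comment> \<open>\<open>remdups_adj_altdef\<close> works with maps monotone on all naturals, so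
    \<open>f\<close> is continued by its last value.\<close>
  define f' where "f' = (\<lambda>i. f (min i (length ws - 1)))"
  have f': "f' i = f i" if "i < length ws" for i
    using that by (auto simp: f'_def min_def intro!: arg_cong[where f = f])
  have fless: "f i < length zs" if "i < length ws" for i
    using im that by blast
  \<comment> \<open>A monotone map that jumped by more than one would miss a value and not be
    surjective.\<close>
  have step: "f (Suc i) = f i \<or> f (Suc i) = Suc (f i)" if i: "Suc i < length ws" for i
  proof (rule ccontr)
    assume neg: "\<not> ?thesis"
    have "f i \<le> f (Suc i)"
      using i by (intro mono_onD[OF mono]) auto
    with neg have gap: "Suc (f i) < f (Suc i)" by linarith
    then have "Suc (f i) \<in> f ` {..<length ws}"
      unfolding im using fless[OF i] by simp
    then obtain j where j: "j < length ws" "f j = Suc (f i)" by auto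
    show False
    proof (cases "j \<le> i")
      case True
      then have "f j \<le> f i"
        using i by (intro mono_onD[OF mono]) auto
      with j show False by simp
    next
      case False
      then have "f (Suc i) \<le> f j"
        using i j by (intro mono_onD[OF mono]) auto
      with j gap show False by simp
    qed
  qed
  have "mono (g \<circ> f')"
  proof (rule monoI)
    fix i j :: nat assume "i \<le> j"
    then have "f' i \<le> f' j"
      unfolding f'_def using len by (intro mono_onD[OF mono]) auto
    then show "(g \<circ> f') i \<le> (g \<circ> f') j"
      using g(1) by (simp add: monoD)
  qed
  moreover have "(g \<circ> f') ` {0..<length ws} = {0..<length (remdups_adj zs)}"
  proof -
    have "f' ` {0..<length ws} = {0..<length zs}"
      using im f' by (auto simp: atLeast0LessThan cong: image_cong_simp)
    then show ?thesis by (simp only: image_comp[symmetric] g(2))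
  qed
  moreover have "\<forall>i<length ws. ws ! i = remdups_adj zs ! (g \<circ> f') i"
    using f f' fless g(3) by simp
  moreover have "(ws ! i = ws ! (i + 1)) = ((g \<circ> f') i = (g \<circ> f') (i + 1))" if "i + 1 < length ws" for i
  proof -
    have i: "i < length ws" "Suc i < length ws" using that by simp_all
    have "(zs ! f i = zs ! f (Suc i)) = (g (f i) = g (f (Suc i)))"
      using step[OF i(2)] g(4)[of "f i"] fless[OF i(2)] by (elim disjE) simp_all
    then show ?thesis
      by (simp add: f[OF i(1)] f[OF i(2)] f'[OF i(1)] f'[OF i(2)])
  qed
  ultimately show ?thesis
    using remdups_adj_altdef[of ws "remdups_adj zs"] by blast
qed

lemma discretisation_times:
  fixes t :: "nat \<Rightarrow> real"
  assumes "t 0 = 0" "t n = 1" "\<And>i. i < n \<Longrightarrow> t i \<le> t (Suc i)" "i \<le> n"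
  shows "t i \<in> {0..1}"
proof -
  have "t j \<le> t k" if "j \<le> k" "k \<le> n" for j k
    using that
  proof (induction k rule: dec_induct)
    case (step k)
    then show ?case using assms(3)[of k] by linarith
  qed simp
  from this[of 0 i] this[of i n] show ?thesis
    using assms by simp
qed

text \<open>Discretisations only constrain the open interval. Since closed balls are closed,
  continuity extends the bound to the ends; if the open interval is empty, the closed one has at
  most one point.\<close>

lemma discretisation_segment:
  fixes \<gamma> :: "real \<Rightarrow> 'a::metric_space"
  assumes "path \<gamma>" "0 \<le> a" "b \<le> 1" "\<theta> \<ge> 0"
    and sub: "\<gamma> ` {a<..<b} \<subseteq> cball (\<gamma> a) \<theta>" and u: "u \<in> {a..b}"
  shows "dist (\<gamma> a) (\<gamma> u) \<le> \<theta>"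
proof (cases "a < b")
  case True
  have "\<gamma> ` closure {a<..<b} \<subseteq> cball (\<gamma> a) \<theta>"
  proof (rule image_closure_subset)
    show "continuous_on (closure {a<..<b}) \<gamma>"
      using assms True by (auto simp: path_def elim: continuous_on_subset)
  qed (use sub in auto)
  with True u show ?thesis
    by fastforce
next
  case False
  with u have "u = a" by auto
  with \<open>\<theta> \<ge> 0\<close> show ?thesis by simp
qed

section \<open>Chains of short paths at one fixed scale\<close>

text \<open>\<open>d\<close> bounds the steps, \<open>r\<close> the connecting paths, and
  \<open>e\<close> is the radius of known homotopies. The condition \<open>2 * r \<le> e\<close>
  keeps two successive connecting paths inside one ball of radius \<open>e\<close>.\<close>

locale connected_scale =
  fixes X :: "'a::metric_space set" and d r e :: real and s :: "'a \<Rightarrow> 'a \<Rightarrow> real \<Rightarrow> 'a"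
  assumes connector: "connector X d r s" and radius: "homotopy_radius X e" and r_le: "2 * r \<le> e"
    and d_pos: "d > 0"
begin

lemma connectorD:
  assumes "x \<in> X" "y \<in> X" "dist x y \<le> d"
  shows "path (s x y)" "path_image (s x y) \<subseteq> X" "path_image (s x y) \<subseteq> ball x r"
    "pathstart (s x y) = x" "pathfinish (s x y) = y"
  using connector assms unfolding connector_def by blast+

lemma small_homotopic:
  assumes "x \<in> X" "path p" "path q" "path_image p \<subseteq> X" "path_image q \<subseteq> X"
    "path_image p \<subseteq> ball x e" "path_image q \<subseteq> ball x e"
    "pathstart p = pathstart q" "pathfinish p = pathfinish q"
  shows "homotopic_paths X p q"
  using radius assms unfolding homotopy_radius_def by blast

lemma e_pos: "e > 0" using radius by (simp add: homotopy_radius_def)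

text \<open>The path \<open>s x x\<close> starts at \<open>x\<close> and lies in
  \<open>ball x r\<close>, so \<open>r > 0\<close>; then \<open>2 * r \<le> e\<close> is
  enough.\<close>

lemma r_less: "x \<in> X \<Longrightarrow> r < e"
  using connectorD(3,4)[of x x] pathstart_in_path_image[of "s x x"] r_le d_pos by auto

lemma chain_path:
  assumes "theta_path d X zs"
  shows "path (chain_path s zs)" "path_image (chain_path s zs) \<subseteq> X"
    "pathstart (chain_path s zs) = hd zs" "pathfinish (chain_path s zs) = last zs"
proof -
  have "path (chain_path s zs) \<and> path_image (chain_path s zs) \<subseteq> X \<and>
      pathstart (chain_path s zs) = hd zs \<and> pathfinish (chain_path s zs) = last zs"
    using assms
  proof (induction zs rule: induct_list012)
    case (3 x y zs)
    then have "x \<in> X" "y \<in> X" "dist x y \<le> d"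
      by (auto dest: theta_path_hd)
    note c = connectorD[OF this]
    have "path_image (s x y +++ chain_path s (y # zs)) \<subseteq> X"
      using 3 c by (intro subset_path_image_join) auto
    with 3 c show ?case by auto
  qed auto
  then show "path (chain_path s zs)" "path_image (chain_path s zs) \<subseteq> X"
    "pathstart (chain_path s zs) = hd zs" "pathfinish (chain_path s zs) = last zs"
    by auto
qed

text \<open>A repeated point \<open>x\<close> contributes the small loop \<open>s x x\<close>, which
  contracts. With \<open>lazification_remdups_adj\<close> this gives invariance under
  lazification.\<close>

lemma chain_path_remdups_adj:
  assumes "theta_path d X zs"
  shows "homotopic_paths X (chain_path s zs) (chain_path s (remdups_adj zs))"
  using assms
proof (induction zs rule: remdups_adj.induct)
  case (3 x y zs)
  then have xy: "x \<in> X" "y \<in> X" "dist x y \<le> d" and tp: "theta_path d X (y # zs)"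
    by (auto dest: theta_path_hd)
  note c = connectorD[OF xy] and cp = chain_path[OF tp]
  show ?case
  proof (cases "x = y")
    case True
    have "homotopic_paths X (s x y) (\<lambda>_. x)"
      using c xy r_less[of x] True e_pos
      by (intro small_homotopic[of x]) auto
    then have "homotopic_paths X (chain_path s (x # y # zs)) ((\<lambda>_. x) +++ chain_path s (y # zs))"
      using c cp by (auto intro!: homotopic_paths_join)
    also have "homotopic_paths X \<dots> (chain_path s (y # zs))"
      using cp True by (intro homotopic_paths_const_join) auto
    also have "homotopic_paths X \<dots> (chain_path s (remdups_adj (y # zs)))"
      using 3 True tp by auto
    finally show ?thesis using True by simp
  next
    case False
    obtain ws where ws: "remdups_adj (y # zs) = y # ws"
      by (metis list.collapse hd_remdups_adj list.sel(1) remdups_adj_Nil_iff list.distinct(1))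
    have "homotopic_paths X (chain_path s (y # zs)) (chain_path s (y # ws))"
      using 3 False tp ws by auto
    then have "homotopic_paths X (s x y +++ chain_path s (y # zs)) (s x y +++ chain_path s (y # ws))"
      using c cp by (auto intro!: homotopic_paths_join)
    then show ?thesis using False ws by simp
  qed
qed auto

text \<open>Each square between the two rows lies in a small ball, so its boundary is null-homotopic.\<close>

lemma chain_path_row:
  assumes "theta_path d X zs" "theta_path d X ws" "list_all2 (\<lambda>x y. dist x y \<le> d) zs ws"
  shows "homotopic_paths X (chain_path s zs +++ s (last zs) (last ws)) (s (hd zs) (hd ws) +++ chain_path s ws)"
  using assms
proof (induction zs arbitrary: ws rule: induct_list012)
  case 1
  then show ?case by simp
next
  case (2 x)
  then obtain y where ws: "ws = [y]" "dist x y \<le> d" "x \<in> X" "y \<in> X"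
    by (auto simp: list_all2_Cons1)
  note c = connectorD[OF ws(3,4,2)]
  have "homotopic_paths X ((\<lambda>_. x) +++ s x y) (s x y)"
    using c by (intro homotopic_paths_const_join) auto
  also have "homotopic_paths X \<dots> (s x y +++ (\<lambda>_. y))"
    using c by (intro homotopic_paths_sym[OF homotopic_paths_join_const]) auto
  finally show ?case using ws by simp
next
  case (3 x y zs)
  then obtain x' y' ws' where ws: "ws = x' # y' # ws'"
    by (auto simp: list_all2_Cons1)
  define V where "V = s (last (y # zs)) (last (y' # ws'))"
  have tz: "theta_path d X (y # zs)" and tw: "theta_path d X (y' # ws')"
    and X: "x \<in> X" "y \<in> X" "x' \<in> X" "y' \<in> X"
    and d: "dist x y \<le> d" "dist x' y' \<le> d" "dist x x' \<le> d" "dist y y' \<le> d"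
    using 3 ws by (auto dest: theta_path_hd)
  have l2: "list_all2 (\<lambda>x y. dist x y \<le> d) (y # zs) (y' # ws')"
    using 3 ws by simp
  have V: "path V" "path_image V \<subseteq> X" "pathstart V = last (y # zs)" "pathfinish V = last (y' # ws')"
  proof -
    have "last (y # zs) \<in> X" "last (y' # ws') \<in> X"
      using tz tw last_in_set unfolding theta_path_def by blast+
    moreover have "dist (last (y # zs)) (last (y' # ws')) \<le> d"
    proof -
      have len: "length zs = length ws'"
        using list_all2_lengthD[OF l2] by simp
      have "dist ((y # zs) ! length zs) ((y' # ws') ! length zs) \<le> d"
        using list_all2_nthD[OF l2, of "length zs"] by simp
      moreover have "last (u # us) = (u # us) ! length us" for u :: 'a and us
        using last_conv_nth[of "u # us"] by simp
      ultimately show ?thesis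
        using len by simp
    qed
    ultimately show "path V" "path_image V \<subseteq> X" "pathstart V = last (y # zs)" "pathfinish V = last (y' # ws')"
      unfolding V_def by (rule connectorD)+
  qed
  note cz = chain_path[OF tz] and cw = chain_path[OF tw]
  note c1 = connectorD[OF X(1,2) d(1)] and c2 = connectorD[OF X(3,4) d(2)]
    and c3 = connectorD[OF X(1,3) d(3)] and c4 = connectorD[OF X(2,4) d(4)]
  let ?C = "chain_path s (y # zs)" and ?C' = "chain_path s (y' # ws')"
  \<comment> \<open>Applied to \<open>y\<close> and \<open>x'\<close>, which are ends of connecting
    paths from \<open>x\<close>; all four sides of the square then lie in
    \<open>ball x e\<close>.\<close>
  have near: "ball z r \<subseteq> ball x e" if "z \<in> ball x r" for z
  proof
    fix u assume "u \<in> ball z r"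
    with that r_le dist_triangle[of x u z] show "u \<in> ball x e" by simp
  qed
  have in_ball: "ball x r \<subseteq> ball x e" "ball y r \<subseteq> ball x e" "ball x' r \<subseteq> ball x e"
  proof -
    show "ball x r \<subseteq> ball x e"
      using r_less[OF X(1)] by (intro subset_ball) simp
    have "y \<in> ball x r" "x' \<in> ball x r"
      using c1(3,5) c3(3,5) pathfinish_in_path_image[of "s x y"] pathfinish_in_path_image[of "s x x'"] by auto
    then show "ball y r \<subseteq> ball x e" "ball x' r \<subseteq> ball x e"
      using near by auto
  qed
  have square: "homotopic_paths X (s x y +++ s y y') (s x x' +++ s x' y')"
  proof (rule small_homotopic[OF X(1)])
    show "path_image (s x y +++ s y y') \<subseteq> ball x e" "path_image (s x x' +++ s x' y') \<subseteq> ball x e"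
      using c1(3) c2(3) c3(3) c4(3) in_ball by (intro subset_path_image_join; blast)+
    show "path_image (s x y +++ s y y') \<subseteq> X" "path_image (s x x' +++ s x' y') \<subseteq> X"
      by (intro subset_path_image_join c1 c2 c3 c4)+
  qed (use c1 c2 c3 c4 in auto)
  \<comment> \<open>The connecting path between the rows moves from right to left: the induction
    hypothesis takes it past the tail, and \<open>square\<close> past the first step.\<close>
  have "homotopic_paths X ((s x y +++ ?C) +++ V) (s x y +++ (?C +++ V))"
    using c1 cz V by (intro homotopic_paths_sym[OF homotopic_paths_assoc]) auto
  also have "homotopic_paths X \<dots> (s x y +++ (s y y' +++ ?C'))"
    by (rule homotopic_paths_join[OF _ 3(2)[OF tz tw l2, folded V_def, unfolded list.sel]])
      (use c1 cz in auto)
  also have "homotopic_paths X \<dots> ((s x y +++ s y y') +++ ?C')"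
    using c1 c4 cw by (intro homotopic_paths_assoc) auto
  also have "homotopic_paths X \<dots> ((s x x' +++ s x' y') +++ ?C')"
    by (rule homotopic_paths_join[OF square]) (use cw c4 in auto)
  also have "homotopic_paths X \<dots> (s x x' +++ (s x' y' +++ ?C'))"
    using c3 c2 cw by (intro homotopic_paths_sym[OF homotopic_paths_assoc]) auto
  finally show ?case
    unfolding V_def ws by simp
qed

text \<open>With common ends, the two connecting paths in \<open>chain_path_row\<close> are loops
  \<open>s x x\<close> and contract.\<close>

lemma chain_path_close:
  assumes zs: "theta_path d X zs" and ws: "theta_path d X ws"
    and close: "list_all2 (\<lambda>x y. dist x y \<le> d) zs ws"
    and ends: "hd zs = hd ws" "last zs = last ws"
  shows "homotopic_paths X (chain_path s zs) (chain_path s ws)"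
proof -
  have const: "homotopic_paths X (s x x) (\<lambda>_. x)" if "x \<in> X" for x
    using connectorD[of x x] that r_less[OF that] d_pos e_pos by (intro small_homotopic[of x]) auto
  have X: "hd zs \<in> X" "last zs \<in> X"
    using zs by (auto simp: theta_path_def)
  note cz = chain_path[OF zs] and cw = chain_path[OF ws]
  have "homotopic_paths X (chain_path s zs) (chain_path s zs +++ (\<lambda>_. last zs))"
    using cz by (intro homotopic_paths_sym[OF homotopic_paths_join_const]) auto
  also have "homotopic_paths X \<dots> (chain_path s zs +++ s (last zs) (last ws))"
    using const[OF X(2)] cz ends by (intro homotopic_paths_join) (auto intro: homotopic_paths_sym)
  also have "homotopic_paths X \<dots> (s (hd zs) (hd ws) +++ chain_path s ws)"
    by (rule chain_path_row[OF zs ws close])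
  also have "homotopic_paths X \<dots> ((\<lambda>_. hd ws) +++ chain_path s ws)"
    using const[OF X(1)] cw ends connectorD(5)[of "hd ws" "hd ws"] X d_pos
    by (intro homotopic_paths_join) auto
  also have "homotopic_paths X \<dots> (chain_path s ws)"
    using cw by (intro homotopic_paths_const_join) auto
  finally show ?thesis .
qed

text \<open>Consecutive rows of the grid are pointwise within \<open>d\<close> and share their ends,
  so the homotopy proceeds row by row.\<close>

lemma chain_path_grid:
  assumes "theta_grid_homotopic d X zs ws"
  shows "homotopic_paths X (chain_path s zs) (chain_path s ws)"
proof -
  from assms obtain n m H where len: "length zs = Suc n" "length ws = Suc n"
    and X: "\<And>i j. i \<le> n \<Longrightarrow> j \<le> m \<Longrightarrow> H i j \<in> X"
    and lip: "\<And>i j i' j'. i \<le> n \<Longrightarrow> j \<le> m \<Longrightarrow> i' \<le> n \<Longrightarrow> j' \<le> m \<Longrightarrow>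
           dist (H i j) (H i' j') \<le> d * (\<bar>real i - real i'\<bar> + \<bar>real j - real j'\<bar>)"
    and H: "\<And>i. i \<le> n \<Longrightarrow> H i 0 = zs ! i" "\<And>i. i \<le> n \<Longrightarrow> H i m = ws ! i"
           "\<And>j. j \<le> m \<Longrightarrow> H 0 j = zs ! 0" "\<And>j. j \<le> m \<Longrightarrow> H n j = zs ! n"
  proof -
    from assms obtain n m H where "length zs = Suc n" "length ws = Suc n"
      "\<forall>i\<le>n. \<forall>j\<le>m. H i j \<in> X"
      "\<forall>i\<le>n. \<forall>j\<le>m. \<forall>i'\<le>n. \<forall>j'\<le>m.
           dist (H i j) (H i' j') \<le> d * (\<bar>real i - real i'\<bar> + \<bar>real j - real j'\<bar>)"
      "\<forall>i\<le>n. H i 0 = zs ! i \<and> H i m = ws ! i"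
      "\<forall>j\<le>m. H 0 j = zs ! 0 \<and> H 0 j = ws ! 0 \<and> H n j = zs ! n \<and> H n j = ws ! n"
      unfolding theta_grid_homotopic_def by blast
    then show ?thesis
      by (intro that[of n m H]) blast+
  qed
  define R where "R = (\<lambda>j. map (\<lambda>i. H i j) [0..<Suc n])"
  have R: "length (R j) = Suc n" "\<And>i. i \<le> n \<Longrightarrow> R j ! i = H i j" for j
    by (auto simp: R_def simp del: upt_Suc)
  have tp: "theta_path d X (R j)" if "j \<le> m" for j
    unfolding theta_path_nth 
  proof (intro conjI allI impI)
    show "R j \<noteq> []"
      using R(1)[of j] by auto
    show "R j ! i \<in> X" if "i < length (R j)" for i
      using that X \<open>j \<le> m\<close> by (simp add: R)
    show "dist (R j ! i) (R j ! Suc i) \<le> d" if "Suc i < length (R j)" for i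
      using that lip[of i j "Suc i" j] \<open>j \<le> m\<close> by (simp add: R)
  qed
  have "homotopic_paths X (chain_path s (R 0)) (chain_path s (R j))" if "j \<le> m" for j
    using that
  proof (induction j)
    case 0
    then show ?case using chain_path[OF tp[of 0]] by simp
  next
    case (Suc j)
    then have "homotopic_paths X (chain_path s (R 0)) (chain_path s (R j))" by simp
    also have "homotopic_paths X \<dots> (chain_path s (R (Suc j)))"
    proof (rule chain_path_close)
      show "theta_path d X (R j)" "theta_path d X (R (Suc j))" using tp Suc by auto
      have "dist (H i j) (H i (Suc j)) \<le> d" if "i \<le> n" for i
        using lip[of i j i "Suc j"] that Suc by simp
      then show "list_all2 (\<lambda>x y. dist x y \<le> d) (R j) (R (Suc j))"
        by (auto simp: list_all2_conv_all_nth R)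
      show "hd (R j) = hd (R (Suc j))" "last (R j) = last (R (Suc j))"
        using H(3,4)[of j] H(3,4)[of "Suc j"] Suc.prems R(1)[of j] R(1)[of "Suc j"] R(2)[of 0] R(2)[of n]
        by (auto simp: hd_conv_nth last_conv_nth simp flip: length_greater_0_conv)
    qed
    finally show ?case .
  qed
  moreover have "R 0 = zs" "R m = ws"
    using H len by (auto simp: list_eq_iff_nth_eq R less_Suc_eq_le)
  ultimately show ?thesis
    by (metis order_refl)
qed

text \<open>It suffices to treat the two generators. In a lazification both chains are homotopic to
  the chain of the same collapsed list.\<close>

lemma chain_path_theta_homotopic:
  assumes "theta_homotopic d X zs ws" "theta_path d X zs"
  shows "homotopic_paths X (chain_path s zs) (chain_path s ws)"
proof -
  have invariant: "homotopic_paths X (chain_path s us) (chain_path s vs)" if "theta_step d X us vs" for us vs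
  proof (cases "lazification us vs")
    case True
    have tp: "theta_path d X us" "theta_path d X vs"
      using that unfolding theta_step_def by blast+
    note h = chain_path_remdups_adj[OF tp(1)] chain_path_remdups_adj[OF tp(2)]
    show ?thesis
      by (rule homotopic_paths_trans[OF h(1) homotopic_paths_sym])
        (use h(2) in \<open>simp only: lazification_remdups_adj[OF True]\<close>)
  next
    case False
    with that have "theta_grid_homotopic d X us vs"
      unfolding theta_step_def by blast
    then show ?thesis
      by (rule chain_path_grid)
  qed
  show ?thesis
    using assms(1) unfolding theta_homotopic_def
  proof (induction rule: equivclp_induct)
    case base
    then show ?case using chain_path[OF assms(2)] by simp
  next
    case (step y z)
    from step.hyps(2) have "homotopic_paths X (chain_path s y) (chain_path s z)"
      using invariant homotopic_paths_sym by blast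
    with step.IH show ?case
      by (rule homotopic_paths_trans)
  qed
qed

text \<open>On each time interval \<open>\<gamma>\<close> stays within \<open>d < e\<close> of its
  left value, and so does not leave the ball in which it can be replaced by the connecting
  path.\<close>

lemma chain_path_discretisation:
  assumes g: "path \<gamma>" "path_image \<gamma> \<subseteq> X" and disc: "theta_discretisation d \<gamma> zs" and "d < e"
  shows "homotopic_paths X (chain_path s zs) \<gamma>"
proof -
  from disc obtain n and t :: "nat \<Rightarrow> real" where t: "t 0 = 0" "t n = 1" "\<And>i. i < n \<Longrightarrow> t i \<le> t (Suc i)"
    and sub: "\<And>i. i < n \<Longrightarrow> \<gamma> ` {t i<..<t (Suc i)} \<subseteq> cball (\<gamma> (t i)) d"
    and zs: "zs = map (\<lambda>i. \<gamma> (t i)) [0..<Suc n]"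
    unfolding theta_discretisation_def by blast
  note t01 = discretisation_times[OF t]
  have sub': "dist (\<gamma> (t i)) (\<gamma> u) \<le> d" if "i < n" "u \<in> {t i..t (Suc i)}" for i u
    using discretisation_segment[OF g(1) _ _ _ sub[OF that(1)] that(2)] t01[of i] t01[of "Suc i"] that(1) d_pos
    by simp
  have gX: "\<gamma> u \<in> X" if "u \<in> {0..1}" for u
    using g that by (auto simp: path_image_def)
  \<comment> \<open>Chains nest to the right, so the induction runs backwards over the tails of
    \<open>\<gamma>\<close>, starting from the constant path at time 1.\<close>
  have "homotopic_paths X (chain_path s (map (\<lambda>i. \<gamma> (t i)) [i..<Suc n])) (\<gamma> \<circ> linepath (t i) 1)"
    if "i \<le> n" for i
    using that
  proof (induction rule: inc_induct)
    case base
    have "\<gamma> \<circ> linepath (t n) 1 = (\<lambda>_. \<gamma> (t n))"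
      using t by (auto simp: linepath_def)
    then show ?case using t gX[of 1] by simp
  next
    case (step i)
    have X: "\<gamma> (t i) \<in> X" "\<gamma> (t (Suc i)) \<in> X"
      using gX t01 step by auto
    have "dist (\<gamma> (t i)) (\<gamma> (t (Suc i))) \<le> d"
      using sub'[of i "t (Suc i)"] t step by auto
    note c = connectorD[OF X this]
    have seg: "path_image (linepath (t i) (t (Suc i))) = {t i..t (Suc i)}"
      using t step by (simp add: closed_segment_eq_real_ivl)
    have lp: "path (\<gamma> \<circ> linepath a b) \<and> path_image (\<gamma> \<circ> linepath a b) \<subseteq> X" if "a \<in> {0..1}" "b \<in> {0..1}" for a b
      using homotopic_paths_compose_unit_interval[OF g, of "linepath a b" "linepath a b"] that
      by (auto simp: closed_segment_eq_real_ivl)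
    have "homotopic_paths X (s (\<gamma> (t i)) (\<gamma> (t (Suc i)))) (\<gamma> \<circ> linepath (t i) (t (Suc i)))"
    proof (rule small_homotopic[OF X(1)])
      show "path_image (s (\<gamma> (t i)) (\<gamma> (t (Suc i)))) \<subseteq> ball (\<gamma> (t i)) e"
        using c(3) r_less[OF X(1)] by auto
      show "path_image (\<gamma> \<circ> linepath (t i) (t (Suc i))) \<subseteq> ball (\<gamma> (t i)) e"
        unfolding path_image_compose seg using sub'[of i] step \<open>d < e\<close> by fastforce
    qed (use c lp[of "t i" "t (Suc i)"] t01 step in \<open>auto simp: pathstart_compose pathfinish_compose\<close>)
    then have "homotopic_paths X (s (\<gamma> (t i)) (\<gamma> (t (Suc i))) +++ chain_path s (map (\<lambda>i. \<gamma> (t i)) [Suc i..<Suc n]))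
       ((\<gamma> \<circ> linepath (t i) (t (Suc i))) +++ (\<gamma> \<circ> linepath (t (Suc i)) 1))"
    proof (rule homotopic_paths_join[OF _ step.IH])
      show "pathfinish (s (\<gamma> (t i)) (\<gamma> (t (Suc i))))
          = pathstart (chain_path s (map (\<lambda>i. \<gamma> (t i)) [Suc i..<Suc n]))"
        unfolding homotopic_paths_imp_pathstart[OF step.IH] c(5) by (simp add: pathstart_compose)
    qed
    also have "(\<gamma> \<circ> linepath (t i) (t (Suc i))) +++ (\<gamma> \<circ> linepath (t (Suc i)) 1)
        = \<gamma> \<circ> (linepath (t i) (t (Suc i)) +++ linepath (t (Suc i)) 1)"
      by (rule joinpaths_compose)
    also have "homotopic_paths X \<dots> (\<gamma> \<circ> linepath (t i) 1)"
      by (rule homotopic_paths_compose_unit_interval[OF g])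
        (use t01[of i] t01[of "Suc i"] step in \<open>auto simp: path_image_join closed_segment_eq_real_ivl\<close>)
    also have "s (\<gamma> (t i)) (\<gamma> (t (Suc i))) +++ chain_path s (map (\<lambda>i. \<gamma> (t i)) [Suc i..<Suc n])
        = chain_path s (map (\<lambda>i. \<gamma> (t i)) [i..<Suc n])"
      using step(2) by (simp add: upt_conv_Cons del: upt_Suc)
    finally show ?case .
  qed
  from this[of 0] show ?thesis
    using t zs by (simp add: linepath_def o_def)
qed

text \<open>Connecting paths of both families for the same pair lie in one ball of radius
  \<open>e\<close>. This compares chains built at different scales.\<close>

lemma chain_path_change_connector:
  assumes "connected_scale X d' r' e s'" "d' \<le> d" "r' < e" "theta_path d' X zs"
  shows "homotopic_paths X (chain_path s' zs) (chain_path s zs)"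
  using assms(4)
proof (induction zs rule: induct_list012)
  case (3 x y zs)
  interpret c': connected_scale X d' r' e s' by fact
  from 3 have xy: "x \<in> X" "y \<in> X" "dist x y \<le> d'" and tp: "theta_path d' X (y # zs)"
    by (auto dest: theta_path_hd)
  note a = c'.connectorD[OF xy] and b = connectorD[OF xy(1,2)]
  have "homotopic_paths X (s' x y) (s x y)"
    using a b xy \<open>d' \<le> d\<close> \<open>r' < e\<close> r_less[OF xy(1)] by (intro small_homotopic[of x]) force+
  then show ?case
    using 3 tp a c'.chain_path[OF tp] by (auto intro!: homotopic_paths_join)
qed (auto)

end

section \<open>Discretisations\<close>

lemma theta_path_map_upt:
  "theta_path \<theta> X (map f [0..<Suc n]) \<longleftrightarrow> (\<forall>i\<le>n. f i \<in> X) \<and> (\<forall>i<n. dist (f i) (f (Suc i)) \<le> \<theta>)"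
  by (auto simp: theta_path_nth less_Suc_eq_le simp del: upt_Suc)

lemma hd_last_map_upt: "hd (map f [0..<Suc n]) = f 0" "last (map f [0..<Suc n]) = f n"
  by (simp_all add: hd_map last_map del: upt_Suc)

section \<open>Refining the times of a discretisation\<close>

text \<open>Each interval between consecutive times is cut into \<open>K\<close> equal pieces;
  \<open>k div K\<close> is the interval and \<open>k mod K\<close> the piece. At
  \<open>k = n * K\<close> the value \<open>t (Suc n)\<close> occurs, but with coefficient
  0.\<close>

definition subdivide :: "nat \<Rightarrow> (nat \<Rightarrow> real) \<Rightarrow> nat \<Rightarrow> real" where
  "subdivide K t k = t (k div K) + real (k mod K) / real K * (t (Suc (k div K)) - t (k div K))"

context
  fixes n K :: nat and t :: "nat \<Rightarrow> real"
  assumes t: "t 0 = 0" "t n = 1" "\<And>i. i < n \<Longrightarrow> t i \<le> t (Suc i)" and K: "K > 0"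
begin

lemma subdivide_ends: "subdivide K t 0 = 0" "subdivide K t (n * K) = 1"
  using t K by (simp_all add: subdivide_def)

lemma subdivide_segment:
  assumes "k < n * K"
  shows "k div K < n" "subdivide K t k \<in> {t (k div K)..t (Suc (k div K))}"
proof -
  show lt: "k div K < n"
    using assms K by (simp add: div_less_iff_less_mult)
  have "real (k mod K) / real K \<in> {0..1}"
    using K by (auto simp: less_imp_le)
  then show "subdivide K t k \<in> {t (k div K)..t (Suc (k div K))}"
    using t(3)[OF lt] mult_left_le_one_le[of "t (Suc (k div K)) - t (k div K)" "real (k mod K) / real K"]
    unfolding subdivide_def by auto
qed

lemma subdivide_unit: "k \<le> n * K \<Longrightarrow> subdivide K t k \<in> {0..1}"
  using subdivide_ends subdivide_segment[of k] discretisation_times[OF t, of "k div K"]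
    discretisation_times[OF t, of "Suc (k div K)"]
  by (cases "k = n * K") auto

lemma subdivide_Suc:
  assumes "k < n * K"
  shows "subdivide K t (Suc k) - subdivide K t k = (t (Suc (k div K)) - t (k div K)) / K"
proof (cases "Suc (k mod K) = K")
  case True
  then have "Suc k div K = Suc (k div K)" "Suc k mod K = 0"
    by (auto simp: div_Suc mod_Suc)
  then have "subdivide K t (Suc k) - subdivide K t k
      = (1 - real (k mod K) / real K) * (t (Suc (k div K)) - t (k div K))"
    by (simp add: subdivide_def algebra_simps)
  also have "1 - real (k mod K) / real K = (real K - real (k mod K)) / real K"
    using K by (simp add: diff_divide_distrib)
  also have "real K - real (k mod K) = 1"
    using True by linarith
  finally show ?thesis by simp
next
  case False
  then have "Suc k div K = k div K" "Suc k mod K = Suc (k mod K)"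
    by (auto simp: div_Suc mod_Suc)
  then show ?thesis
    using K by (simp add: subdivide_def field_simps)
qed

lemma subdivide_mesh: "k < n * K \<Longrightarrow> \<bar>subdivide K t (Suc k) - subdivide K t k\<bar> \<le> 1 / K"
  using subdivide_Suc[of k] subdivide_segment(1)[of k] t(3)[of "k div K"] K
    discretisation_times[OF t, of "k div K"] discretisation_times[OF t, of "Suc (k div K)"]
  by (simp add: divide_right_mono)

end

text \<open>
  A refinement of a discretisation need not be a \<open>\<theta>\<close>-discretisation, since the radius \<open>\<theta>\<close> is
  measured from the left end of each segment; instead the value at each
  subdivision point is compared with the value at the left end of its segment.
\<close>

lemma discretisation_homotopic_subdivision:
  fixes \<gamma> :: "real \<Rightarrow> 'a::metric_space"
  assumes g: "path \<gamma>" "path_image \<gamma> \<subseteq> X" and "\<theta> > 0" and K: "K > 1"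
    and t: "t 0 = 0" "t n = 1" "\<And>i. i < n \<Longrightarrow> t i \<le> t (Suc i)"
    and sub: "\<And>i. i < n \<Longrightarrow> \<gamma> ` {t i<..<t (Suc i)} \<subseteq> cball (\<gamma> (t i)) \<theta>"
    and fine: "\<And>k. k < n * K \<Longrightarrow> dist (\<gamma> (subdivide K t k)) (\<gamma> (subdivide K t (Suc k))) \<le> \<theta>"
  shows "theta_homotopic \<theta> X (map (\<lambda>i. \<gamma> (t i)) [0..<Suc n])
           (map (\<lambda>k. \<gamma> (subdivide K t k)) [0..<Suc (n * K)])"
proof -
  have K0: "K > 0" using K by simp
  have n: "n > 0" using t by (cases n) auto
  note t01 = discretisation_times[OF t]
  have sd: "k div K < n" "subdivide K t k \<in> {t (k div K)..t (Suc (k div K))}" if "k < n * K" for k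
    using subdivide_segment[OF t K0] that by simp_all
  note sd01 = subdivide_unit[OF t K0] and sde = subdivide_ends[OF t K0]
  have near: "dist (\<gamma> (t i)) (\<gamma> u) \<le> \<theta>" if "i < n" "u \<in> {t i..t (Suc i)}" for i u
    using discretisation_segment[OF g(1) _ _ _ sub[OF that(1)] that(2)] t01[of i] t01[of "Suc i"] that(1) \<open>\<theta> > 0\<close>
    by simp
  have gX: "\<gamma> u \<in> X" if "u \<in> {0..1}" for u
    using g that by (auto simp: path_image_def)
  have le: "k div K \<le> n" if "k \<le> n * K" for k
    using div_le_mono[OF that, of K] K0 by simp
  define Z where "Z = map (\<lambda>i. \<gamma> (t i)) [0..<Suc n]"
  \<comment> \<open>\<open>W\<close> bridges \<open>Z\<close> and \<open>U\<close>: it holds each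
    point of \<open>Z\<close> for \<open>K\<close> indices (the last for one), so it lazifies
    \<open>Z\<close> and has the length of \<open>U\<close>.\<close>
  define W where "W = map (\<lambda>k. \<gamma> (t (k div K))) [0..<Suc (n * K)]"
  define U where "U = map (\<lambda>k. \<gamma> (subdivide K t k)) [0..<Suc (n * K)]"
  have tpZ: "theta_path \<theta> X Z"
    unfolding Z_def theta_path_map_upt using t01 gX near t(3) by simp
  have step: "dist (\<gamma> (t i)) (\<gamma> (t (Suc i))) \<le> \<theta>" if "i < n" for i
    using near[OF that, of "t (Suc i)"] t(3)[OF that] by simp
  have stepW: "dist (\<gamma> (t (k div K))) (\<gamma> (t (Suc k div K))) \<le> \<theta>" if "k < n * K" for k
    using step[OF sd(1)[OF that]] \<open>\<theta> > 0\<close> by (simp add: div_Suc)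
  have tpW: "theta_path \<theta> X W"
    unfolding W_def theta_path_map_upt using t01 gX le stepW by simp
  have tpU: "theta_path \<theta> X U"
    unfolding U_def theta_path_map_upt using sd01 gX fine by simp
  have "lazification Z W"
    unfolding lazification_def
  proof (intro conjI exI[of _ "\<lambda>k. k div K"])
    \<comment> \<open>A lazification must be strictly longer, hence \<open>K > 1\<close> and
      \<open>n > 0\<close>.\<close>
    show "length Z < length W"
      using n K by (simp add: Z_def W_def del: upt_Suc)
    show "mono_on {..<length W} (\<lambda>k. k div K)"
      by (intro mono_onI div_le_mono)
    show "(\<lambda>k. k div K) ` {..<length W} = {..<length Z}"
    proof (intro equalityI subsetI)
      fix i assume "i \<in> {..<length Z}"
      then show "i \<in> (\<lambda>k. k div K) ` {..<length W}"
        using K0 by (intro image_eqI[of _ _ "i * K"]) (auto simp: Z_def W_def less_Suc_eq_le simp del: upt_Suc)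
    qed (use le in \<open>auto simp: Z_def W_def less_Suc_eq_le simp del: upt_Suc\<close>)
    show "\<forall>i<length W. W ! i = Z ! (i div K)"
      using le by (auto simp: Z_def W_def less_Suc_eq_le simp del: upt_Suc)
  qed
  then have "theta_homotopic \<theta> X Z W"
    using tpZ tpW by (intro theta_step_imp_homotopic) (simp add: theta_step_def)
  \<comment> \<open>Two rows suffice: each point of \<open>U\<close> is within
    \<open>\<theta>\<close> of the left end of its own segment, which is the entry of
    \<open>W\<close> at that index.\<close>
  moreover have "theta_grid_homotopic \<theta> X W U"
  proof (rule grid_homotopicI[where n = "n * K" and m = 1
        and H = "\<lambda>k j. if j = 0 then \<gamma> (t (k div K)) else \<gamma> (subdivide K t k)"])
    show "dist (if j = 0 then \<gamma> (t (k div K)) else \<gamma> (subdivide K t k))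
          (if Suc j = 0 then \<gamma> (t (k div K)) else \<gamma> (subdivide K t k)) \<le> \<theta>"
      if "k \<le> n * K" "j < 1" for k j
    proof (cases "k = n * K")
      case True
      then show ?thesis using t sde K0 that \<open>\<theta> > 0\<close> by simp
    next
      case False
      then have "k < n * K" using that by simp
      with near[OF sd] that show ?thesis by simp
    qed
  qed (use t t01 le sd01 gX stepW fine sde K0 in \<open>auto simp: W_def U_def less_Suc_eq_le simp del: upt_Suc\<close>)
  then have "theta_homotopic \<theta> X W U"
    using tpW tpU by (intro theta_step_imp_homotopic) (simp add: theta_step_def)
  ultimately show ?thesis
    unfolding Z_def U_def by (rule theta_homotopic_trans)
qed

section \<open>Independence of the loop and of the chosen times\<close>

text \<open>Refine both time sequences to a common length and sample the homotopy on a grid so fine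
  that uniform continuity bounds each step by \<open>\<theta>\<close>. The case of a constant
  homotopy gives independence of the times.\<close>

lemma discretisations_homotopic:
  fixes \<gamma> \<gamma>' :: "real \<Rightarrow> 'a::metric_space"
  assumes hom: "homotopic_paths X \<gamma> \<gamma>'" and "\<theta> > 0"
    and disc: "theta_discretisation \<theta> \<gamma> zs" "theta_discretisation \<theta> \<gamma>' ws"
  shows "theta_homotopic \<theta> X zs ws"
proof -
  let ?Q = "{0..1::real} \<times> {0..1::real}"
  obtain h where h: "continuous_on ?Q h" "h \<in> ?Q \<rightarrow> X"
    and h0: "\<And>x. x \<in> {0..1} \<Longrightarrow> h (0, x) = \<gamma> x" and h1: "\<And>x. x \<in> {0..1} \<Longrightarrow> h (1, x) = \<gamma>' x"
    and ends: "\<And>a. a \<in> {0..1} \<Longrightarrow> h (a, 0) = \<gamma> 0" "\<And>a. a \<in> {0..1} \<Longrightarrow> h (a, 1) = \<gamma> 1"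
    using hom unfolding homotopic_paths by (auto simp: pathstart_def pathfinish_def)
  have g: "path \<gamma>" "path_image \<gamma> \<subseteq> X" "path \<gamma>'" "path_image \<gamma>' \<subseteq> X"
    using homotopic_paths_imp_path[OF hom] homotopic_paths_imp_subset[OF hom] by auto
  have "uniformly_continuous_on ?Q h"
    by (intro compact_uniformly_continuous h compact_Times) auto
  then obtain \<delta> where \<delta>: "\<delta> > 0"
      "\<And>p q. p \<in> ?Q \<Longrightarrow> q \<in> ?Q \<Longrightarrow> dist q p < \<delta> \<Longrightarrow> dist (h q) (h p) < \<theta>"
    using \<open>\<theta> > 0\<close> unfolding uniformly_continuous_on_def by metis
  have unif: "dist (h (a, b)) (h (a', b')) \<le> \<theta>"
    if "a \<in> {0..1}" "b \<in> {0..1}" "a' \<in> {0..1}" "b' \<in> {0..1}" "\<bar>a - a'\<bar> + \<bar>b - b'\<bar> < \<delta>" for a b a' b'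
  proof -
    have "dist (a, b) (a', b') \<le> \<bar>a - a'\<bar> + \<bar>b - b'\<bar>"
      using sqrt_sum_squares_le_sum_abs[of "a - a'" "b - b'"] by (simp add: dist_Pair_Pair dist_real_def)
    with \<delta>(2)[of "(a', b')" "(a, b)"] that show ?thesis by (auto intro: less_imp_le)
  qed
  \<comment> \<open>Both the homotopy parameter and the times will advance by at most
    \<open>1 / J\<close>; a vertical grid step changes both at once, hence the factor 2.\<close>
  obtain J where J: "J > 2" "2 / real J < \<delta>"
  proof -
    obtain N where "real N > max 2 (2 / \<delta>)"
      using reals_Archimedean2 by blast
    then show ?thesis
      using \<delta>(1) by (intro that[of N]) (auto simp: field_simps)
  qed
  from disc(1) obtain n and t :: "nat \<Rightarrow> real"
    where t: "t 0 = 0" "t n = 1" "\<And>i. i < n \<Longrightarrow> t i \<le> t (Suc i)"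
    and sub: "\<And>i. i < n \<Longrightarrow> \<gamma> ` {t i<..<t (Suc i)} \<subseteq> cball (\<gamma> (t i)) \<theta>"
    and zs: "zs = map (\<lambda>i. \<gamma> (t i)) [0..<Suc n]"
    unfolding theta_discretisation_def by blast
  from disc(2) obtain n' and t' :: "nat \<Rightarrow> real"
    where t': "t' 0 = 0" "t' n' = 1" "\<And>i. i < n' \<Longrightarrow> t' i \<le> t' (Suc i)"
    and sub': "\<And>i. i < n' \<Longrightarrow> \<gamma>' ` {t' i<..<t' (Suc i)} \<subseteq> cball (\<gamma>' (t' i)) \<theta>"
    and ws: "ws = map (\<lambda>i. \<gamma>' (t' i)) [0..<Suc n']"
    unfolding theta_discretisation_def by blast
  have n: "n > 0" "n' > 0"
    using t t' by (cases n; cases n'; auto)+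
  \<comment> \<open>Factors chosen so that both subdivisions have the same length.\<close>
  define K K' where "K = n' * J" and "K' = n * J"
  define M where "M = n * K"
  have M': "M = n' * K'" by (simp add: M_def K_def K'_def)
  have JK: "J \<le> K" "J \<le> K'"
    using n by (simp_all add: K_def K'_def)
  then have K1: "K > 1" "K' > 1" and K0: "K > 0" "K' > 0" using J by auto
  have mesh_le: "1 / real K \<le> 1 / real J" "1 / real K' \<le> 1 / real J"
    using JK J by (auto simp: field_simps)
  define u v where "u = subdivide K t" and "v = subdivide K' t'"
  have u01: "u k \<in> {0..1}" and v01: "v k \<in> {0..1}" if "k \<le> M" for k
    using subdivide_unit[OF t K0(1)] subdivide_unit[OF t' K0(2)] that
    unfolding u_def v_def M'[symmetric] by (simp_all add: M_def)
  have u_mesh: "\<bar>u (Suc k) - u k\<bar> \<le> 1 / J" and v_mesh: "\<bar>v (Suc k) - v k\<bar> \<le> 1 / J" if "k < M" for k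
    using subdivide_mesh[OF t K0(1), of k] subdivide_mesh[OF t' K0(2), of k] that mesh_le
    unfolding u_def v_def M'[symmetric] by (simp_all add: M_def)
  have uv_ends: "u 0 = 0" "v 0 = 0" "u M = 1" "v M = 1"
    using subdivide_ends[OF t K0(1)] subdivide_ends[OF t' K0(2)] unfolding u_def v_def M'[symmetric]
    by (simp_all add: M_def)
  define c where "c = (\<lambda>j. real j / real J)"
  \<comment> \<open>The times move linearly from \<open>u\<close> to \<open>v\<close> while the
    homotopy parameter goes from 0 to 1, so that the outer rows are exactly \<open>U\<close> and
    \<open>V\<close>.\<close>
  define w where "w = (\<lambda>k j. (1 - c j) * u k + c j * v k)"
  have c01: "c j \<in> {0..1}" if "j \<le> J" for j
    using that J by (auto simp: c_def)
  have w01: "w k j \<in> {0..1}" if "k \<le> M" "j \<le> J" for k j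
  proof -
    have "convex {0..1::real}" by simp
    then show ?thesis
      unfolding w_def using u01[of k] v01[of k] c01[of j] that by (auto intro!: convex_bound_le)
  qed
  have w_mesh: "\<bar>w (Suc k) j - w k j\<bar> \<le> 1 / J" if "k < M" "j \<le> J" for k j
  proof -
    have "w (Suc k) j - w k j = (1 - c j) * (u (Suc k) - u k) + c j * (v (Suc k) - v k)"
      by (simp add: w_def algebra_simps)
    also have "\<bar>\<dots>\<bar> \<le> (1 - c j) * (1 / J) + c j * (1 / J)"
    proof (rule order_trans[OF abs_triangle_ineq], rule add_mono)
      show "\<bar>(1 - c j) * (u (Suc k) - u k)\<bar> \<le> (1 - c j) * (1 / J)"
        using c01[OF that(2)] u_mesh[OF that(1)] by (simp only: abs_mult) (intro mult_mono, auto)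
      show "\<bar>c j * (v (Suc k) - v k)\<bar> \<le> c j * (1 / J)"
        using c01[OF that(2)] v_mesh[OF that(1)] by (simp only: abs_mult) (intro mult_mono, auto)
    qed
    also have "(1 - c j) * (1 / J) + c j * (1 / J) = 1 / J"
      by (simp only: distrib_right[symmetric]) simp
    finally show ?thesis .
  qed
  have c_Suc: "c (Suc j) - c j = 1 / J" for j
    by (simp add: c_def diff_divide_distrib[symmetric])
  have w_vert: "\<bar>w k (Suc j) - w k j\<bar> \<le> 1 / J" if "k \<le> M" for k j
  proof -
    have "w k (Suc j) - w k j = (c (Suc j) - c j) * (v k - u k)"
      by (simp add: w_def algebra_simps)
    also have "\<bar>\<dots>\<bar> \<le> 1 / J * 1"
      unfolding c_Suc abs_mult using u01[OF that] v01[OF that] by (intro mult_mono) auto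
    finally show ?thesis by simp
  qed
  have J\<delta>: "1 / real J < \<delta>" "1 / real J + 1 / real J < \<delta>"
    using J by (auto simp: field_simps)
  define U V where "U = map (\<lambda>k. \<gamma> (u k)) [0..<Suc M]" and "V = map (\<lambda>k. \<gamma>' (v k)) [0..<Suc M]"
  have fine_u: "dist (\<gamma> (u k)) (\<gamma> (u (Suc k))) \<le> \<theta>" and fine_v: "dist (\<gamma>' (v k)) (\<gamma>' (v (Suc k))) \<le> \<theta>"
    if "k < M" for k
    using unif[of 0 "u k" 0 "u (Suc k)"] unif[of 1 "v k" 1 "v (Suc k)"] u_mesh[OF that] v_mesh[OF that] J\<delta>
      u01[of k] u01[of "Suc k"] v01[of k] v01[of "Suc k"] that h0 h1 by (auto simp: abs_minus_commute)
  have "theta_grid_homotopic \<theta> X U V"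
  proof (rule grid_homotopicI[where n = M and m = J and H = "\<lambda>k j. h (c j, w k j)"])
    show "h (c j, w k j) \<in> X" if "k \<le> M" "j \<le> J" for k j
      using h(2) c01 w01 that by blast
    show "dist (h (c j, w k j)) (h (c j, w (Suc k) j)) \<le> \<theta>" if "k < M" "j \<le> J" for k j
      using that c01 w01 w_mesh[OF that] J\<delta> by (intro unif) (auto simp: abs_minus_commute)
    show "dist (h (c j, w k j)) (h (c (Suc j), w k (Suc j))) \<le> \<theta>" if "k \<le> M" "j < J" for k j
      using that c01[of j] c01[of "Suc j"] w01[of k j] w01[of k "Suc j"] w_vert[OF that(1), of j] c_Suc[of j] J\<delta>
      by (intro unif) (auto simp: abs_minus_commute)
    have cJ: "c 0 = 0" "c J = 1" using J by (simp_all add: c_def)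
    show "h (c 0, w k 0) = U ! k" "h (c J, w k J) = V ! k" if "k \<le> M" for k
      using that u01[OF that] v01[OF that] h0 h1
      by (simp_all add: w_def cJ U_def V_def less_Suc_eq_le del: upt_Suc)
    show "h (c j, w 0 j) = U ! 0" "h (c j, w M j) = U ! M" if "j \<le> J" for j
      using c01[OF that] ends uv_ends by (auto simp: w_def U_def simp del: upt_Suc)
  qed (auto simp: U_def V_def)
  moreover have "theta_path \<theta> X U" "theta_path \<theta> X V"
    unfolding U_def V_def theta_path_map_upt
    using fine_u fine_v u01 v01 g by (auto simp: path_image_def)
  ultimately have "theta_homotopic \<theta> X U V"
    by (intro theta_step_imp_homotopic) (simp add: theta_step_def)
  moreover have "theta_homotopic \<theta> X zs U"
    unfolding zs U_def u_def M_def
    by (rule discretisation_homotopic_subdivision[OF g(1,2) \<open>\<theta> > 0\<close> K1(1) t sub])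
      (use fine_u in \<open>auto simp: u_def M_def\<close>)
  moreover have "theta_homotopic \<theta> X ws V"
    unfolding ws V_def v_def M'
    by (rule discretisation_homotopic_subdivision[OF g(3,4) \<open>\<theta> > 0\<close> K1(2) t' sub'])
      (use fine_v in \<open>auto simp: v_def M'\<close>)
  ultimately show ?thesis
    by (meson theta_homotopic_sym theta_homotopic_trans)
qed

lemma discretisation_theta_path:
  fixes \<gamma> :: "real \<Rightarrow> 'a::metric_space"
  assumes g: "path \<gamma>" "path_image \<gamma> \<subseteq> X" and "\<theta> > 0" and "theta_discretisation \<theta> \<gamma> zs"
  shows "theta_path \<theta> X zs" "hd zs = pathstart \<gamma>" "last zs = pathfinish \<gamma>"
proof -
  from assms(4) obtain n and t :: "nat \<Rightarrow> real"
    where t: "t 0 = 0" "t n = 1" "\<And>i. i < n \<Longrightarrow> t i \<le> t (Suc i)"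
    and sub: "\<And>i. i < n \<Longrightarrow> \<gamma> ` {t i<..<t (Suc i)} \<subseteq> cball (\<gamma> (t i)) \<theta>"
    and zs: "zs = map (\<lambda>i. \<gamma> (t i)) [0..<Suc n]"
    unfolding theta_discretisation_def by blast
  note t01 = discretisation_times[OF t]
  have "dist (\<gamma> (t i)) (\<gamma> (t (Suc i))) \<le> \<theta>" if "i < n" for i
    using discretisation_segment[OF g(1) _ _ _ sub[OF that], of "t (Suc i)"] t01[of i] t01[of "Suc i"] t(3) that
      \<open>\<theta> > 0\<close> by simp
  then show "theta_path \<theta> X zs"
    unfolding zs theta_path_map_upt using g(2) t01 by (auto simp: path_image_def)
  show "hd zs = pathstart \<gamma>" "last zs = pathfinish \<gamma>"
    unfolding zs hd_last_map_upt using t by (simp_all add: pathstart_def pathfinish_def)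
qed

lemma discretisation_exists:
  fixes \<gamma> :: "real \<Rightarrow> 'a::metric_space"
  assumes "path \<gamma>" "\<theta> > 0"
  shows "\<exists>zs. theta_discretisation \<theta> \<gamma> zs"
proof -
  have "uniformly_continuous_on {0..1} \<gamma>"
    using assms(1) by (intro compact_uniformly_continuous) (auto simp: path_def)
  then obtain \<delta> where \<delta>: "\<delta> > 0"
      "\<And>p q. p \<in> {0..1} \<Longrightarrow> q \<in> {0..1} \<Longrightarrow> dist q p < \<delta> \<Longrightarrow> dist (\<gamma> q) (\<gamma> p) < \<theta>"
    using \<open>\<theta> > 0\<close> unfolding uniformly_continuous_on_def by metis
  obtain N where N: "N > 0" "1 / real N < \<delta>"
    using real_arch_inverse[of \<delta>] \<delta>(1) by (auto simp: inverse_eq_divide)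
  have "\<gamma> ` {real i / N<..<real (Suc i) / N} \<subseteq> cball (\<gamma> (real i / N)) \<theta>" if "i < N" for i
  proof (clarsimp)
    fix u assume u: "real i / N < u" "u < (1 + real i) / N"
    have i: "0 \<le> real i / N" "real (Suc i) / N \<le> 1"
      using that N by (auto simp: field_simps)
    have "(1 + real i) / N = real i / N + 1 / N"
      by (simp add: add_divide_distrib)
    then have "dist (real i / N) u < \<delta>"
      using u N by (simp add: dist_real_def)
    moreover have "real i / N \<in> {0..1}"
      using that by simp
    moreover from i u have "u \<in> {0..1}"
      unfolding atLeastAtMost_iff of_nat_Suc by (intro conjI) linarith+
    ultimately show "dist (\<gamma> (real i / N)) (\<gamma> u) \<le> \<theta>"
      using \<delta>(2)[of u "real i / N"] by (simp add: less_imp_le)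
  qed
  then show ?thesis
    unfolding theta_discretisation_def using N(1)
    by (intro exI[of _ "map (\<lambda>i. \<gamma> (real i / N)) [0..<Suc N]"] exI[of _ N] exI[of _ "\<lambda>i. real i / N"])
      (auto simp: divide_right_mono simp del: upt_Suc)
qed

text \<open>The times are squeezed into the two halves of the unit interval; the common point of the
  two paths is listed once, hence \<open>tl ws\<close>.\<close>

lemma discretisation_join:
  fixes \<gamma> \<gamma>' :: "real \<Rightarrow> 'a::metric_space"
  assumes "theta_discretisation \<theta> \<gamma> zs" "theta_discretisation \<theta> \<gamma>' ws" "pathfinish \<gamma> = pathstart \<gamma>'"
  shows "theta_discretisation \<theta> (\<gamma> +++ \<gamma>') (zs @ tl ws)"
proof -
  from assms(1) obtain n and t :: "nat \<Rightarrow> real"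
    where t: "t 0 = 0" "t n = 1" "\<And>i. i < n \<Longrightarrow> t i \<le> t (Suc i)"
    and sub: "\<And>i. i < n \<Longrightarrow> \<gamma> ` {t i<..<t (Suc i)} \<subseteq> cball (\<gamma> (t i)) \<theta>"
    and zs: "zs = map (\<lambda>i. \<gamma> (t i)) [0..<Suc n]"
    unfolding theta_discretisation_def by blast
  from assms(2) obtain n' and t' :: "nat \<Rightarrow> real"
    where t': "t' 0 = 0" "t' n' = 1" "\<And>i. i < n' \<Longrightarrow> t' i \<le> t' (Suc i)"
    and sub': "\<And>i. i < n' \<Longrightarrow> \<gamma>' ` {t' i<..<t' (Suc i)} \<subseteq> cball (\<gamma>' (t' i)) \<theta>"
    and ws: "ws = map (\<lambda>i. \<gamma>' (t' i)) [0..<Suc n']"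
    unfolding theta_discretisation_def by blast
  have t01: "t i \<in> {0..1}" if "i \<le> n" for i
    using discretisation_times[OF t] that by simp
  have t01': "t' i \<in> {0..1}" if "i \<le> n'" for i
    using discretisation_times[OF t'] that by simp
  \<comment> \<open>At \<open>i = n\<close> both formulas give \<open>1/2\<close>, so the second one
    holds for \<open>n + i\<close> with \<open>i = 0\<close> too.\<close>
  define T where "T = (\<lambda>i. if i \<le> n then t i / 2 else (1 + t' (i - n)) / 2)"
  have T1: "T i = t i / 2" if "i \<le> n" for i
    using that by (simp add: T_def)
  have T2: "T (n + i) = (1 + t' i) / 2" for i
    using t t' by (cases i) (auto simp: T_def)
  have eq: "\<gamma> 1 = \<gamma>' 0"
    using assms(3) by (simp add: pathstart_def pathfinish_def)
  have J1: "(\<gamma> +++ \<gamma>') u = \<gamma> (2 * u)" if "u \<le> 1/2" for u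
    using that by (simp add: joinpaths_def)
  \<comment> \<open>At \<open>1/2\<close> the join takes its value from \<open>\<gamma>\<close>; the
    matching ends make the formula valid there.\<close>
  have J2: "(\<gamma> +++ \<gamma>') u = \<gamma>' (2 * u - 1)" if "u \<ge> 1/2" for u
  proof (cases "u = 1/2")
    case True
    show ?thesis unfolding True using eq by (simp add: joinpaths_def)
  qed (use that in \<open>simp add: joinpaths_def\<close>)
  have P1: "(\<gamma> +++ \<gamma>') (T i) = \<gamma> (t i)" if "i \<le> n" for i
    using t01[OF that] that by (simp add: J1 T1)
  have P2: "(\<gamma> +++ \<gamma>') (T (n + i)) = \<gamma>' (t' i)" if "i \<le> n'" for i
  proof -
    have "(\<gamma> +++ \<gamma>') (T (n + i)) = \<gamma>' (2 * ((1 + t' i) / 2) - 1)"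
      unfolding T2 using t01'[OF that] by (intro J2) simp
    also have "2 * ((1 + t' i) / 2) - 1 = t' i"
      by (simp add: field_simps)
    finally show ?thesis .
  qed
  have step: "T i \<le> T (Suc i) \<and> (\<gamma> +++ \<gamma>') ` {T i<..<T (Suc i)} \<subseteq> cball ((\<gamma> +++ \<gamma>') (T i)) \<theta>"
    if "i < n + n'" for i
  proof (cases "i < n")
    case True
    have "(\<gamma> +++ \<gamma>') u \<in> cball (\<gamma> (t i)) \<theta>" if "u \<in> {T i<..<T (Suc i)}" for u
    proof -
      have u: "2 * u \<in> {t i<..<t (Suc i)}" "u \<le> 1/2"
        using that True t01[of "Suc i"] by (auto simp: T1)
      with sub[OF True] show ?thesis unfolding J1[OF u(2)] by blast
    qed
    moreover have "(\<gamma> +++ \<gamma>') (T i) = \<gamma> (t i)"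
      using True by (intro P1) simp
    moreover have "T i \<le> T (Suc i)"
      using True t(3)[OF True] by (simp add: T1)
    ultimately show ?thesis
      by auto
  next
    case False
    define k where "k = i - n"
    have k: "i = n + k" "k < n'" using False that by (auto simp: k_def)
    have Tk: "T (Suc i) = (1 + t' (Suc k)) / 2" "T i = (1 + t' k) / 2"
      using T2[of "Suc k"] T2[of k] k by simp_all
    have "(\<gamma> +++ \<gamma>') u \<in> cball (\<gamma>' (t' k)) \<theta>" if "u \<in> {T i<..<T (Suc i)}" for u
    proof -
      have u: "2 * u - 1 \<in> {t' k<..<t' (Suc k)}" "u \<ge> 1/2"
        using that k t01'[of k] unfolding Tk by auto
      with sub'[OF k(2)] show ?thesis unfolding J2[OF u(2)] by blast
    qed
    moreover have "(\<gamma> +++ \<gamma>') (T i) = \<gamma>' (t' k)"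
      using P2[of k] k by simp
    moreover have "T i \<le> T (Suc i)"
      using t'(3)[OF k(2)] by (simp add: Tk)
    ultimately show ?thesis
      by auto
  qed
  have "zs @ tl ws = map (\<lambda>i. (\<gamma> +++ \<gamma>') (T i)) [0..<Suc (n + n')]"
  proof (rule nth_equalityI)
    show "length (zs @ tl ws) = length (map (\<lambda>i. (\<gamma> +++ \<gamma>') (T i)) [0..<Suc (n + n')])"
      by (simp add: zs ws del: upt_Suc)
    fix i assume "i < length (zs @ tl ws)"
    then have i: "i \<le> n + n'" by (simp add: zs ws del: upt_Suc)
    show "(zs @ tl ws) ! i = map (\<lambda>i. (\<gamma> +++ \<gamma>') (T i)) [0..<Suc (n + n')] ! i"
    proof (cases "i \<le> n")
      case True
      with i show ?thesis by (simp add: zs nth_append P1 less_Suc_eq_le del: upt_Suc)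
    next
      case False
      define k where "k = i - Suc n"
      have k: "i = n + Suc k" "Suc k \<le> n'" using False i by (auto simp: k_def)
      with P2[OF k(2)] i show ?thesis
        by (simp add: zs ws nth_append nth_tl less_Suc_eq_le del: upt_Suc)
    qed
  qed
  moreover have "T 0 = 0" "T (n + n') = 1"
    using t t' T1[of 0] T2[of n'] by simp_all
  ultimately show ?thesis
    unfolding theta_discretisation_def using step
    by (intro exI[of _ "n + n'"] exI[of _ T]) (simp del: upt_Suc)
qed

text \<open>Well-definedness: all classes in the union defining \<open>discretise\<close> coincide
  by \<open>discretisations_homotopic\<close>.\<close>

lemma discretise_eq:
  fixes X :: "'a::metric_space set"
  assumes \<gamma>: "\<gamma> \<in> based_loops X x0" and "\<theta> > 0" and zs: "theta_discretisation \<theta> \<gamma> zs"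
  shows "zs \<in> theta_loops \<theta> X x0"
    and "discretise \<theta> X x0 (loop_rel X x0 `` {\<gamma>}) = theta_loop_rel \<theta> X x0 `` {zs}"
proof -
  have mem: "ws \<in> theta_loops \<theta> X x0" if "\<beta> \<in> based_loops X x0" "theta_discretisation \<theta> \<beta> ws" for \<beta> ws
    using discretisation_theta_path[of \<beta> X \<theta> ws] that \<open>\<theta> > 0\<close>
    by (auto simp: based_loops_def theta_loops_def)
  show "zs \<in> theta_loops \<theta> X x0"
    using mem[OF \<gamma> zs] .
  have "theta_loop_rel \<theta> X x0 `` {ws} = theta_loop_rel \<theta> X x0 `` {zs}"
    if "(\<gamma>, \<beta>) \<in> loop_rel X x0" "theta_discretisation \<theta> \<beta> ws" for \<beta> ws
  proof (rule equiv_class_eq[OF equiv_theta_loop_rel])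
    have "theta_homotopic \<theta> X zs ws"
      using that zs \<open>\<theta> > 0\<close> by (auto simp: loop_rel_def intro: discretisations_homotopic)
    then show "(ws, zs) \<in> theta_loop_rel \<theta> X x0"
      using that mem \<gamma> zs by (auto simp: loop_rel_def theta_loop_rel_def intro: theta_homotopic_sym)
  qed
  moreover have "(\<gamma>, \<gamma>) \<in> loop_rel X x0"
    using \<gamma> by (auto simp: loop_rel_def based_loops_def)
  ultimately show "discretise \<theta> X x0 (loop_rel X x0 `` {\<gamma>}) = theta_loop_rel \<theta> X x0 `` {zs}"
    unfolding discretise_def using zs by blast
qed

section \<open>The discretisation homomorphism\<close>

lemma theta_discretisation_mono:
  assumes "theta_discretisation \<theta>' \<gamma> zs" "\<theta>' \<le> \<theta>"
  shows "theta_discretisation \<theta> \<gamma> zs"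
proof -
  have *: "cball x \<theta>' \<subseteq> cball x \<theta>" for x :: 'a
    using assms(2) by (rule subset_cball)
  from assms(1) obtain n and t :: "nat \<Rightarrow> real" where t: "t 0 = 0" "t n = 1" "\<forall>i<n. t i \<le> t (Suc i)"
    and sub: "\<forall>i<n. \<gamma> ` {t i<..<t (Suc i)} \<subseteq> cball (\<gamma> (t i)) \<theta>'"
    and zs: "zs = map (\<lambda>i. \<gamma> (t i)) [0..<Suc n]"
    unfolding theta_discretisation_def by blast
  have "\<forall>i<n. \<gamma> ` {t i<..<t (Suc i)} \<subseteq> cball (\<gamma> (t i)) \<theta>"
    using sub subset_trans[OF _ *] by blast
  with t zs show ?thesis
    unfolding theta_discretisation_def by (intro exI[of _ n] exI[of _ t] conjI)
qed

lemma discretisation_small: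
  assumes "path_image p \<subseteq> cball (pathstart p) \<theta>"
  shows "theta_discretisation \<theta> p [pathstart p, pathfinish p]"
  unfolding theta_discretisation_def using assms
  by (intro exI[of _ 1] exI[of _ "\<lambda>i::nat. if i = 0 then 0 else 1"])
    (auto simp: path_image_def pathstart_def pathfinish_def)

text \<open>A connecting path stays within \<open>r \<le> \<theta>\<close> of its start, so its two
  ends discretise it. The final constant piece contributes the extra copy of the last point.\<close>

lemma (in connected_scale) chain_path_is_discretised_by:
  assumes "theta_path d X zs" "r \<le> \<theta>" "\<theta> > 0"
  shows "theta_discretisation \<theta> (chain_path s zs) (zs @ [last zs])"
  using assms(1)
proof (induction zs rule: induct_list012)
  case (2 x)
  then show ?case
    using discretisation_small[of "\<lambda>_::real. x" \<theta>] assms(3) by simp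
next
  case (3 x y zs)
  then have "x \<in> X" "y \<in> X" "dist x y \<le> d" and tp: "theta_path d X (y # zs)"
    by (auto dest: theta_path_hd)
  note c = connectorD[OF this(1-3)]
  have "theta_discretisation \<theta> (s x y) [x, y]"
    using discretisation_small[of "s x y" \<theta>] c \<open>r \<le> \<theta>\<close> by force
  from discretisation_join[OF this 3(2)[OF tp]] show ?case
    using c chain_path[OF tp] by simp
qed simp

text \<open>Removes the extra point that comes from the constant end of
  \<open>chain_path\<close>.\<close>

lemma theta_homotopic_repeat_last:
  assumes "theta_path \<theta> X zs" "\<theta> > 0"
  shows "theta_homotopic \<theta> X zs (zs @ [last zs])"
proof (rule theta_step_imp_homotopic)
  have ne: "zs \<noteq> []" using assms(1) by (simp add: theta_path_def)
  have "lazification zs (zs @ [last zs])"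
    unfolding lazification_def
  proof (intro conjI exI[of _ "\<lambda>i. min i (length zs - 1)"])
    show "(\<lambda>i. min i (length zs - 1)) ` {..<length (zs @ [last zs])} = {..<length zs}"
    proof (intro equalityI subsetI)
      fix i assume "i \<in> {..<length zs}"
      then show "i \<in> (\<lambda>i. min i (length zs - 1)) ` {..<length (zs @ [last zs])}"
        by (intro image_eqI[of _ _ i]) auto
    qed (use ne in \<open>auto simp: min_less_iff_disj\<close>)
    show "\<forall>i<length (zs @ [last zs]). (zs @ [last zs]) ! i = zs ! min i (length zs - 1)"
      using ne by (auto simp: nth_append min_def last_conv_nth less_Suc_eq)
  qed (auto intro!: mono_onI simp: min_def)
  moreover have "theta_path \<theta> X (zs @ [last zs])"
    using assms ne by (auto simp: theta_path_def successively_append_iff)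
  ultimately show "theta_step \<theta> X zs (zs @ [last zs])"
    using assms(1) by (simp add: theta_step_def)
qed

lemma carrier_fundamental_group: "carrier (fundamental_group X x0) = based_loops X x0 // loop_rel X x0"
  by (simp add: fundamental_group_def class_group_def)

lemma carrier_discrete_fundamental_group:
  "carrier (discrete_fundamental_group \<theta> X x0) = theta_loops \<theta> X x0 // theta_loop_rel \<theta> X x0"
  by (simp add: discrete_fundamental_group_def class_group_def)

lemma based_loops_join: "p \<in> based_loops X x0 \<Longrightarrow> q \<in> based_loops X x0 \<Longrightarrow> p +++ q \<in> based_loops X x0"
  by (auto simp: based_loops_def subset_path_image_join)

lemma mult_fundamental_group:
  assumes "p \<in> based_loops X x0" "q \<in> based_loops X x0"
  shows "loop_rel X x0 `` {p} \<otimes>\<^bsub>fundamental_group X x0\<^esub> loop_rel X x0 `` {q} = loop_rel X x0 `` {p +++ q}"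
  unfolding fundamental_group_def
proof (rule class_group_mult[OF equiv_loop_rel _ assms])
  show "(p +++ q, p' +++ q') \<in> loop_rel X x0"
    if "(p, p') \<in> loop_rel X x0" "(q, q') \<in> loop_rel X x0" for p p' q q'
    using that by (auto simp: loop_rel_def based_loops_join) (auto simp: based_loops_def intro: homotopic_paths_join)
qed

lemma mult_discrete_fundamental_group:
  assumes "\<theta> > 0" "p \<in> theta_loops \<theta> X x0" "q \<in> theta_loops \<theta> X x0"
  shows "theta_loop_rel \<theta> X x0 `` {p} \<otimes>\<^bsub>discrete_fundamental_group \<theta> X x0\<^esub> theta_loop_rel \<theta> X x0 `` {q}
     = theta_loop_rel \<theta> X x0 `` {p @ tl q}"
  unfolding discrete_fundamental_group_def
  by (rule class_group_mult[OF equiv_theta_loop_rel]) (use assms in \<open>auto intro: theta_loop_rel_concat\<close>)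

lemma carrier_discrete_limit_group:
  "carrier (discrete_limit_group X x0) =
     {c \<in> \<Pi>\<^sub>E \<theta>\<in>{0<..}. carrier (discrete_fundamental_group \<theta> X x0).
        \<forall>\<theta>' \<theta>. 0 < \<theta>' \<and> \<theta>' \<le> \<theta> \<longrightarrow> scale_map \<theta> X x0 (c \<theta>') = c \<theta>}"
  by (simp add: discrete_limit_group_def)

lemma mult_discrete_limit_group:
  "c \<otimes>\<^bsub>discrete_limit_group X x0\<^esub> c' = (\<lambda>\<theta>\<in>{0<..}. c \<theta> \<otimes>\<^bsub>discrete_fundamental_group \<theta> X x0\<^esub> c' \<theta>)"
  by (simp add: discrete_limit_group_def)

lemma based_loops_discretisation_exists:
  assumes "\<gamma> \<in> based_loops X x0" "\<theta> > 0"
  obtains zs where "theta_discretisation \<theta> \<gamma> zs"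
  using discretisation_exists[of \<gamma> \<theta>] assms by (auto simp: based_loops_def)

text \<open>Compatibility holds because one list discretises the loop at the finer and at the
  coarser scale; multiplicativity comes from \<open>discretisation_join\<close>.\<close>

lemma discretisation_hom_in_hom:
  "discretisation_hom X x0 \<in> hom (fundamental_group X x0) (discrete_limit_group X x0)"
proof (rule homI)
  fix P assume "P \<in> carrier (fundamental_group X x0)"
  then obtain \<gamma> where \<gamma>: "\<gamma> \<in> based_loops X x0" and P: "P = loop_rel X x0 `` {\<gamma>}"
    unfolding carrier_fundamental_group by (auto elim: quotientE)
  have "discretise \<theta> X x0 P \<in> carrier (discrete_fundamental_group \<theta> X x0)" if \<theta>: "\<theta> > 0" for \<theta>
  proof -
    obtain zs where zs: "theta_discretisation \<theta> \<gamma> zs"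
      using based_loops_discretisation_exists[OF \<gamma> \<theta>] .
    show ?thesis
      unfolding P discretise_eq(2)[OF \<gamma> \<theta> zs] carrier_discrete_fundamental_group
      by (rule quotientI) (rule discretise_eq(1)[OF \<gamma> \<theta> zs])
  qed
  moreover have "scale_map \<theta> X x0 (discretise \<theta>' X x0 P) = discretise \<theta> X x0 P"
    if \<theta>: "0 < \<theta>'" "\<theta>' \<le> \<theta>" for \<theta> \<theta>'
  proof -
    have "\<theta> > 0" using \<theta> by simp
    obtain zs where zs: "theta_discretisation \<theta>' \<gamma> zs"
      using based_loops_discretisation_exists[OF \<gamma> \<theta>(1)] .
    then have zs': "theta_discretisation \<theta> \<gamma> zs"
      using \<theta>(2) by (rule theta_discretisation_mono)
    show ?thesis
      unfolding P discretise_eq(2)[OF \<gamma> \<theta>(1) zs] discretise_eq(2)[OF \<gamma> \<open>\<theta> > 0\<close> zs']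
      by (rule scale_map_class[OF \<theta>(2) discretise_eq(1)[OF \<gamma> \<theta>(1) zs]])
  qed
  ultimately show "discretisation_hom X x0 P \<in> carrier (discrete_limit_group X x0)"
    unfolding carrier_discrete_limit_group discretisation_hom_def by auto
next
  fix P Q assume "P \<in> carrier (fundamental_group X x0)" "Q \<in> carrier (fundamental_group X x0)"
  then obtain p q where p: "p \<in> based_loops X x0" "P = loop_rel X x0 `` {p}"
    and q: "q \<in> based_loops X x0" "Q = loop_rel X x0 `` {q}"
    unfolding carrier_fundamental_group by (auto elim!: quotientE)
  have "discretise \<theta> X x0 (P \<otimes>\<^bsub>fundamental_group X x0\<^esub> Q)
      = discretise \<theta> X x0 P \<otimes>\<^bsub>discrete_fundamental_group \<theta> X x0\<^esub> discretise \<theta> X x0 Q" if \<theta>: "\<theta> > 0" for \<theta>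
  proof -
    obtain zs ws where zs: "theta_discretisation \<theta> p zs" and ws: "theta_discretisation \<theta> q ws"
      using based_loops_discretisation_exists[OF p(1) \<theta>] based_loops_discretisation_exists[OF q(1) \<theta>] .
    have pq: "theta_discretisation \<theta> (p +++ q) (zs @ tl ws)"
      using p q by (intro discretisation_join zs ws) (simp add: based_loops_def)
    show ?thesis
      unfolding p(2) q(2) mult_fundamental_group[OF p(1) q(1)]
        discretise_eq(2)[OF based_loops_join[OF p(1) q(1)] \<theta> pq]
        discretise_eq(2)[OF p(1) \<theta> zs] discretise_eq(2)[OF q(1) \<theta> ws]
        mult_discrete_fundamental_group[OF \<theta> discretise_eq(1)[OF p(1) \<theta> zs] discretise_eq(1)[OF q(1) \<theta> ws]] ..
  qed
  then show "discretisation_hom X x0 (P \<otimes>\<^bsub>fundamental_group X x0\<^esub> Q)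
      = discretisation_hom X x0 P \<otimes>\<^bsub>discrete_limit_group X x0\<^esub> discretisation_hom X x0 Q"
    unfolding mult_discrete_limit_group discretisation_hom_def by (intro restrict_ext) simp
qed

section \<open>Injectivity and surjectivity\<close>

lemma connected_scale_exists:
  assumes "compact X" "locally path_connected X" "homotopy_radius X e" "\<eta> > 0"
  obtains d r s where "connected_scale X d r e s" "d \<le> \<eta>" "r \<le> \<eta>" "d < e" "r < e"
proof -
  have e: "e > 0" using assms(3) by (simp add: homotopy_radius_def)
  define r where "r = min \<eta> (e / 2)"
  obtain d s where d: "d > 0" "connector X d r s"
    using connector_exists[OF assms(1,2), of r] e assms(4) by (auto simp: r_def)
  show ?thesis
  \<comment> \<open>Shrinking the step bound keeps the same connecting paths and makes it inherit
    the bounds on \<open>r\<close>.\<close>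
  proof (rule that[of "min d r" r s])
    show "connected_scale X (min d r) r e s"
      by unfold_locales (use d e assms in \<open>auto simp: connector_def r_def\<close>)
  qed (use e in \<open>auto simp: r_def\<close>)
qed

lemma inj_on_discretisation_hom:
  fixes X :: "'a::metric_space set"
  assumes "compact X" "locally path_connected X" "homotopy_radius X e"
  shows "inj_on (discretisation_hom X x0) (carrier (fundamental_group X x0))"
proof (rule inj_onI)
  fix P Q
  assume PQ: "P \<in> carrier (fundamental_group X x0)" "Q \<in> carrier (fundamental_group X x0)"
    and eq: "discretisation_hom X x0 P = discretisation_hom X x0 Q"
  from PQ obtain p q where p: "p \<in> based_loops X x0" "P = loop_rel X x0 `` {p}"
    and q: "q \<in> based_loops X x0" "Q = loop_rel X x0 `` {q}"
    unfolding carrier_fundamental_group by (auto elim!: quotientE)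
  obtain d r s where cs: "connected_scale X d r e s" and "d < e"
    using connected_scale_exists[OF assms zero_less_one] by metis
  interpret connected_scale X d r e s by fact
  obtain zs ws where zs: "theta_discretisation d p zs" and ws: "theta_discretisation d q ws"
    using based_loops_discretisation_exists[OF p(1) d_pos] based_loops_discretisation_exists[OF q(1) d_pos] .
  \<comment> \<open>Only the coordinate at the single scale \<open>d\<close> is read off from the
    two families.\<close>
  have "discretise d X x0 P = discretise d X x0 Q"
    using fun_cong[OF eq, of d] d_pos by (simp add: discretisation_hom_def)
  then have "theta_loop_rel d X x0 `` {zs} = theta_loop_rel d X x0 `` {ws}"
    unfolding p(2) q(2) discretise_eq(2)[OF p(1) d_pos zs] discretise_eq(2)[OF q(1) d_pos ws] .
  then have "(zs, ws) \<in> theta_loop_rel d X x0"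
    using eq_equiv_class[OF _ equiv_theta_loop_rel discretise_eq(1)[OF q(1) d_pos ws]] by blast
  then have h: "theta_homotopic d X zs ws" "theta_path d X zs"
    by (auto simp: theta_loop_rel_def theta_loops_def)
  have pq: "path p" "path_image p \<subseteq> X" "path q" "path_image q \<subseteq> X"
    using p q by (auto simp: based_loops_def)
  have "homotopic_paths X p (chain_path s zs)"
    using chain_path_discretisation[OF pq(1,2) zs \<open>d < e\<close>] by (rule homotopic_paths_sym)
  also have "homotopic_paths X \<dots> (chain_path s ws)"
    using h by (rule chain_path_theta_homotopic)
  also have "homotopic_paths X \<dots> q"
    by (rule chain_path_discretisation[OF pq(3,4) ws \<open>d < e\<close>])
  finally show "P = Q"
    unfolding p(2) q(2) using p q
    by (intro equiv_class_eq[OF equiv_loop_rel]) (simp add: loop_rel_def)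
qed

lemma discretisation_hom_surj:
  fixes X :: "'a::metric_space set"
  assumes "compact X" "locally path_connected X" "homotopy_radius X e"
    and c: "c \<in> carrier (discrete_limit_group X x0)"
  shows "c \<in> discretisation_hom X x0 ` carrier (fundamental_group X x0)"
proof -
  have c_ext: "c \<in> extensional {0<..}"
    and c_mem: "\<And>\<theta>. \<theta> > 0 \<Longrightarrow> c \<theta> \<in> theta_loops \<theta> X x0 // theta_loop_rel \<theta> X x0"
    and c_compat: "\<And>\<theta> \<theta>'. 0 < \<theta>' \<Longrightarrow> \<theta>' \<le> \<theta> \<Longrightarrow> scale_map \<theta> X x0 (c \<theta>') = c \<theta>"
    using c unfolding carrier_discrete_limit_group carrier_discrete_fundamental_group
    by (auto simp: PiE_def Pi_def)
  obtain d r s where cs: "connected_scale X d r e s" "d < e"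
    using connected_scale_exists[OF assms(1-3) zero_less_one] by metis
  interpret connected_scale X d r e s by fact
  obtain zs where zs: "zs \<in> theta_loops d X x0" "c d = theta_loop_rel d X x0 `` {zs}"
    using c_mem[OF d_pos] by (auto elim: quotientE)
  \<comment> \<open>The loop is fixed at scale \<open>d\<close>, before any \<open>\<theta>\<close>
    is considered.\<close>
  define \<gamma> where "\<gamma> = chain_path s zs"
  have \<gamma>: "\<gamma> \<in> based_loops X x0"
    using chain_path[of zs] zs(1) by (simp add: \<gamma>_def based_loops_def theta_loops_def)
  have "discretise \<theta> X x0 (loop_rel X x0 `` {\<gamma>}) = c \<theta>" if \<theta>: "\<theta> > 0" for \<theta>
  proof -
    \<comment> \<open>A scale below both \<open>\<theta>\<close> and \<open>d\<close> links them:
      \<open>c d'\<close> determines \<open>c \<theta>\<close> as well as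
      \<open>c d\<close>.\<close>
    have "min \<theta> d > 0" using \<theta> d_pos by simp
    then obtain d' r' s' where cs': "connected_scale X d' r' e s'" and
      le: "d' \<le> \<theta>" "d' \<le> d" "r' \<le> \<theta>" "r' < e"
      using connected_scale_exists[OF assms(1-3), of "min \<theta> d"] by (metis min.boundedE)
    interpret c': connected_scale X d' r' e s' by fact
    obtain ws where ws: "ws \<in> theta_loops d' X x0" "c d' = theta_loop_rel d' X x0 `` {ws}"
      using c_mem[OF c'.d_pos] by (auto elim: quotientE)
    define \<gamma>' where "\<gamma>' = chain_path s' ws"
    have tp: "theta_path d' X ws" "hd ws = x0" "last ws = x0"
      using ws(1) by (auto simp: theta_loops_def)
    have \<gamma>': "\<gamma>' \<in> based_loops X x0"
      using c'.chain_path[OF tp(1)] tp by (simp add: \<gamma>'_def based_loops_def)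
    \<comment> \<open>Compatibility of \<open>c\<close>, read at scale \<open>d\<close>, makes the
      finer representative \<open>ws\<close> homotopic to \<open>zs\<close> there; hence the chains
      of both are homotopic.\<close>
    have "theta_loop_rel d X x0 `` {ws} = theta_loop_rel d X x0 `` {zs}"
      using c_compat[OF c'.d_pos le(2)] unfolding ws(2) zs(2) scale_map_class[OF le(2) ws(1)] .
    then have "(ws, zs) \<in> theta_loop_rel d X x0"
      using eq_equiv_class[OF _ equiv_theta_loop_rel zs(1)] by blast
    then have h: "theta_homotopic d X ws zs" "theta_path d X ws"
      by (auto simp: theta_loop_rel_def theta_loops_def)
    have "homotopic_paths X \<gamma>' (chain_path s ws)"
      unfolding \<gamma>'_def by (rule chain_path_change_connector[OF cs' le(2,4) tp(1)])
    also have "homotopic_paths X \<dots> \<gamma>"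
      unfolding \<gamma>_def using h by (rule chain_path_theta_homotopic)
    finally have "(\<gamma>', \<gamma>) \<in> loop_rel X x0"
      using \<gamma> \<gamma>' by (simp add: loop_rel_def)
    then have "loop_rel X x0 `` {\<gamma>} = loop_rel X x0 `` {\<gamma>'}"
      using equiv_class_eq[OF equiv_loop_rel] by blast
    moreover have disc: "theta_discretisation \<theta> \<gamma>' (ws @ [last ws])"
      unfolding \<gamma>'_def by (rule c'.chain_path_is_discretised_by[OF tp(1) le(3) \<theta>])
    ultimately have "discretise \<theta> X x0 (loop_rel X x0 `` {\<gamma>}) = theta_loop_rel \<theta> X x0 `` {ws @ [last ws]}"
      using discretise_eq(2)[OF \<gamma>' \<theta> disc] by simp
    also have "\<dots> = theta_loop_rel \<theta> X x0 `` {ws}"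
    proof (rule equiv_class_eq[OF equiv_theta_loop_rel])
      have "theta_homotopic \<theta> X ws (ws @ [last ws])"
        using theta_path_mono[OF tp(1) le(1)] \<theta> by (rule theta_homotopic_repeat_last)
      then show "(ws @ [last ws], ws) \<in> theta_loop_rel \<theta> X x0"
        using discretise_eq(1)[OF \<gamma>' \<theta> disc] theta_loop_rel_mono(2)[OF le(1), of X x0] ws(1)
        by (auto simp: theta_loop_rel_def intro: theta_homotopic_sym)
    qed
    also have "\<dots> = c \<theta>"
      using c_compat[OF c'.d_pos le(1)] unfolding ws(2) scale_map_class[OF le(1) ws(1)] .
    finally show ?thesis .
  qed
  \<comment> \<open>For \<open>\<theta> \<le> 0\<close> both families take the value
    \<open>undefined\<close>.\<close>
  then have "discretisation_hom X x0 (loop_rel X x0 `` {\<gamma>}) = c"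
    using c_ext by (intro ext) (simp add: discretisation_hom_def extensional_def restrict_def)
  moreover have "loop_rel X x0 `` {\<gamma>} \<in> carrier (fundamental_group X x0)"
    unfolding carrier_fundamental_group using \<gamma> by (rule quotientI)
  ultimately show ?thesis by blast
qed

theorem theorem1p3:
  fixes X :: "'a::metric_space set" and x0 :: 'a
  assumes "compact X"
    and "locally path_connected X"
    and "semilocally_simply_connected X"
    and "x0 \<in> X"
  shows "discretisation_hom X x0 \<in> iso (fundamental_group X x0) (discrete_limit_group X x0)
       \<and> fundamental_group X x0 \<cong> discrete_limit_group X x0"
proof -
  obtain e where e: "homotopy_radius X e"
    using homotopy_radius_exists[OF assms(1,3)] by blast
  have "discretisation_hom X x0 ` carrier (fundamental_group X x0) = carrier (discrete_limit_group X x0)"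
    using discretisation_hom_surj[OF assms(1,2) e] hom_carrier[OF discretisation_hom_in_hom] by blast
  then have "discretisation_hom X x0 \<in> iso (fundamental_group X x0) (discrete_limit_group X x0)"
    using inj_on_discretisation_hom[OF assms(1,2) e] discretisation_hom_in_hom
    by (simp add: iso_def bij_betw_def)
  then show ?thesis
    by (auto simp: is_iso_def)
qed

end
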